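(* Let $\Omega\subset\mathbb R^d$ ($d=2,3$) be a smooth bounded connected domain with boundary $\Gamma$, and let $\delta t>0$ be arbitrary. For $k\in\{g,l\}$ let $\widetilde k$ denote the other phase. Let $(\phi_k^m,\rho_k^m,\bm u_k^m,p^m)$, $m=0,1,2,\ldots$, together with intermediate quantities $\widetilde\alpha_k^{m+1},\widetilde\phi_k^{m+1},\widetilde\rho_k^{m+1},\widetilde p_k^{m+1},\widetilde{\bm u}_k^{m+1},\overline{\bm u}_k^{m+1}$, be (sufficiently smooth) solutions of the semi-discrete scheme described in the context, with given initial data $\phi_k^0,\rho_k^0,\bm u_k^0,p^0,\widetilde\phi_k^0,\widetilde\rho_k^0$ and $\alpha_k^0=\phi_k^0\rho_k^0$. Then for every $m\ge 0$, $$\begin{aligned} &\sum_{k=g,l}\Big[\tfrac12\big\|\sqrt{\alpha_k^{m+1}}\,\bm u_k^{m+1}\big\|_{L^2}^2+\int_\Omega\alpha_k^{m+1}e_k(\rho_k^{m+1})\,dx+\delta t\sum_{j=0}^m\big(\widetilde\phi_k^{j+1}\tau_k(\widetilde{\bm u}_k^{j+1}),\nabla\widetilde{\bm u}_k^{j+1}\big)+\tfrac12\delta t^2\Big\|\sqrt{\tfrac{\widetilde\phi_k^{m+1}}{\widetilde\rho_k^{m+1}}}\nabla p^{m+1}\Big\|_{L^2}^2\Big]\\ &\quad+\delta t\sum_{j=0}^m\int_\Omega C_D\,\widetilde\phi_g^{j+1}\widetilde\phi_l^{j+1}\,|\widetilde{\bm u}_g^{j+1}-\widetilde{\bm u}_l^{j+1}|^3\,dx\\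 &\le\sum_{k=g,l}\Big(\tfrac12\big\|\sqrt{\alpha_k^0}\,\bm u_k^0\big\|_{L^2}^2+\int_\Omega\alpha_k^0e_k(\rho_k^0)\,dx+\tfrac12\delta t^2\Big\|\sqrt{\tfrac{\widetilde\phi_k^0}{\widetilde\rho_k^0}}\nabla p^0\Big\|_{L^2}^2\Big). \end{aligned}$$
   Context: Model: two phases $k=g,l$ with volume fractions $\phi_k$ ($\phi_g+\phi_l=1$, and throughout one works with $\phi_k>0$), densities $\rho_k>0$, $\alpha_k=\phi_k\rho_k$, velocities $\bm u_k$ and a common pressure $p$. Stress tensors $\tau_k(\bm u)=2\mu_k D(\bm u)+\lambda_k(\nabla\cdot\bm u)I$, where $D(\bm u)$ is the symmetric part of $\nabla\bm u$ and $\mu_k,\lambda_k$ are viscosities; $C_D>0$ is a constant drag coefficient. Equations of state: $p=\zeta_g(\rho_g)=\zeta_l(\rho_l)$ with $\zeta_g(z)=A_gz^{\gamma_g}$, $\zeta_l(z)=A_l(z^{\gamma_l}-\rho_{l,0}^{\gamma_l})+p_0$, where $A_g,A_l,\rho_{l,0},p_0>0$ and $\gamma_g,\gamma_l>1$. Potential energies: $e_k(z)=\int_{\rho_{k,\mathrm{ref}}}^z\zeta_k(s)/s^2\,ds$ for suitable reference constants $\rho_{k,\mathrm{ref}}>0$. Velocities vanish on $\Gamma$ (homogeneous Dirichlet conditions, so all velocity fields, including $\overline{\bm u}_k^{m+1}$, have zero normal component on $\Gamma$). $(\cdot,\cdot)$ is the $L^2(\Omega)$ inner product and $A:B$ the Frobenius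 product, so $(\phi\tau,\nabla\bm u)=\int_\Omega\phi\,\tau:\nabla\bm u$. Scheme (for $m\ge0$, $k=g,l$): Step 1: $\frac{\widetilde\alpha_k^{m+1}-\alpha_k^m}{\delta t}+\nabla\cdot(\widetilde\alpha_k^{m+1}\bm u_k^m)=0$. Step 2: determine $\widetilde\phi_k^{m+1},\widetilde\rho_k^{m+1}$ from $\widetilde\phi_g^{m+1}+\widetilde\phi_l^{m+1}=1$, $\widetilde\phi_k^{m+1}\widetilde\rho_k^{m+1}=\widetilde\alpha_k^{m+1}$, $\zeta_g(\widetilde\rho_g^{m+1})=\zeta_l(\widetilde\rho_l^{m+1})$. Step 3: $\nabla\cdot\big(\frac{\widetilde\phi_k^{m+1}}{\widetilde\rho_k^{m+1}}\nabla\widetilde p_k^{m+1}\big)=\nabla\cdot\Big(\sqrt{\frac{\widetilde\phi_k^{m+1}\widetilde\phi_k^m}{\widetilde\rho_k^{m+1}\widetilde\rho_k^m}}\nabla p^m\Big)$ in $\Omega$, with $\frac{\widetilde\phi_k^{m+1}}{\widetilde\rho_k^{m+1}}\partial_n\widetilde p_k^{m+1}=\sqrt{\frac{\widetilde\phi_k^{m+1}\widetilde\phi_k^m}{\widetilde\rho_k^{m+1}\widetilde\rho_k^m}}\partial_n p^m$ on $\Gamma$. Step 4: $\frac{\widetilde\alpha_k^{m+1}\widetilde{\bm u}_k^{m+1}-\alpha_k^m\bm u_k^m}{\delta t}+\nabla\cdot(\widetilde\alpha_k^{m+1}\bm u_k^m\otimes\widetilde{\bm u}_k^{m+1})+\widetilde\phi_k^{m+1}\nabla\widetilde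 p_k^{m+1}-\nabla\cdot(\widetilde\phi_k^{m+1}\tau_k(\widetilde{\bm u}_k^{m+1}))+C_D\widetilde\phi_g^{m+1}\widetilde\phi_l^{m+1}|\widetilde{\bm u}_g^{m+1}-\widetilde{\bm u}_l^{m+1}|(\widetilde{\bm u}_k^{m+1}-\widetilde{\bm u}_{\widetilde k}^{m+1})=0$, with $\widetilde{\bm u}_k^{m+1}=0$ on $\Gamma$. Step 5 (projection): solve for $\overline{\bm u}_k^{m+1},p^{m+1},\phi_k^{m+1},\rho_k^{m+1}$: $\widetilde\alpha_k^{m+1}\frac{\overline{\bm u}_k^{m+1}-\widetilde{\bm u}_k^{m+1}}{\delta t}+\widetilde\phi_k^{m+1}\nabla(p^{m+1}-\widetilde p_k^{m+1})=0$; $\frac{\phi_k^{m+1}\rho_k^{m+1}-\phi_k^m\rho_k^m}{\delta t}+\nabla\cdot(\widetilde\phi_k^{m+1}\rho_k^{m+1}\overline{\bm u}_k^{m+1})=0$; $\phi_g^{m+1}+\phi_l^{m+1}=1$; $\rho_k^{m+1}=\zeta_k^{-1}(p^{m+1})$; with $\partial_n p^{m+1}=\partial_n\widetilde p_k^{m+1}$ on $\Gamma$. Step 6: $\alpha_k^{m+1}=\phi_k^{m+1}\rho_k^{m+1}$ and $\sqrt{\alpha_k^{m+1}}\bm u_k^{m+1}=\sqrt{\widetilde\alpha_k^{m+1}}\,\overline{\bm u}_k^{m+1}$. Here $\alpha_k^0=\phi_k^0\rho_k^0$ and all $\phi$'s, $\rho$'s, $\alpha$'s, $\widetilde\phi$'s,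 $\widetilde\rho$'s, $\widetilde\alpha$'s are assumed positive. *)

theory Defs
  imports "HOL-Analysis.Analysis"
begin

datatype phase = Gas | Liq

fun other :: "phase \<Rightarrow> phase" where
  "other Gas = Liq"
| "other Liq = Gas"

definition pd :: "'n::finite \<Rightarrow> (real^'n \<Rightarrow> real) \<Rightarrow> real^'n \<Rightarrow> real" where
  "pd i f x = frechet_derivative f (at x) (axis i 1)"

fun hpd :: "'n::finite list \<Rightarrow> (real^'n \<Rightarrow> real) \<Rightarrow> real^'n \<Rightarrow> real" where
  "hpd [] f = f"
| "hpd (i # is) f = pd i (hpd is f)"

definition Ck_on :: "nat \<Rightarrow> (real^'n::finite) set \<Rightarrow> (real^'n \<Rightarrow> real) \<Rightarrow> bool" where
  "Ck_on k U f \<longleftrightarrow>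
     (\<forall>is. length is < k \<longrightarrow> (\<forall>x\<in>U. hpd is f differentiable (at x))) \<and>
     (\<forall>is. length is \<le> k \<longrightarrow> continuous_on U (hpd is f))"

definition smooth_on :: "(real^'n::finite) set \<Rightarrow> (real^'n \<Rightarrow> real) \<Rightarrow> bool" where
  "smooth_on U f \<longleftrightarrow> (\<forall>k. Ck_on k U f)"

definition vCk_on :: "nat \<Rightarrow> (real^'n::finite) set \<Rightarrow> (real^'n \<Rightarrow> real^'n) \<Rightarrow> bool" where
  "vCk_on k U u \<longleftrightarrow> (\<forall>i. Ck_on k U (\<lambda>x. u x $ i))"

definition sgrad :: "(real^'n::finite \<Rightarrow> real) \<Rightarrow> real^'n \<Rightarrow> real^'n" where
  "sgrad f x = (\<chi> i. pd i f x)"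

definition vdiv :: "(real^'n::finite \<Rightarrow> real^'n) \<Rightarrow> real^'n \<Rightarrow> real" where
  "vdiv u x = (\<Sum>i\<in>UNIV. pd i (\<lambda>y. u y $ i) x)"

definition jac :: "(real^'n::finite \<Rightarrow> real^'n) \<Rightarrow> real^'n \<Rightarrow> real^'n^'n" where
  "jac u x = (\<chi> i j. pd j (\<lambda>y. u y $ i) x)"

definition symgrad :: "(real^'n::finite \<Rightarrow> real^'n) \<Rightarrow> real^'n \<Rightarrow> real^'n^'n" where
  "symgrad u x = (1/2) *\<^sub>R (jac u x + transpose (jac u x))"

definition stress :: "real \<Rightarrow> real \<Rightarrow> (real^'n::finite \<Rightarrow> real^'n) \<Rightarrow> real^'n \<Rightarrow> real^'n^'n" where
  "stress mu lam u x = (2 * mu) *\<^sub>R symgrad u x + (lam * vdiv u x) *\<^sub>R mat 1"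

text \<open>Divergence of a tensor field, taken over the first index:
  (div T)_i = sum_j d_j T_ji, so that div (a (x) b) = (a . grad) b + (div a) b.\<close>
definition tdiv :: "(real^'n::finite \<Rightarrow> real^'n^'n) \<Rightarrow> real^'n \<Rightarrow> real^'n" where
  "tdiv T x = (\<chi> i. \<Sum>j\<in>UNIV. pd j (\<lambda>y. T y $ j $ i) x)"

definition outer :: "real^'n::finite \<Rightarrow> real^'n \<Rightarrow> real^'n^'n" where
  "outer a b = (\<chi> i j. a $ i * b $ j)"

definition frob :: "real^'n::finite^'n \<Rightarrow> real^'n^'n \<Rightarrow> real" where
  "frob A B = (\<Sum>i\<in>UNIV. \<Sum>j\<in>UNIV. A $ i $ j * B $ i $ j)"

text \<open>Omega is described by a smooth defining function psi: Omega = {psi < 0},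
  with nonvanishing gradient on {psi = 0} (which is the boundary Gamma).\<close>
definition smooth_bounded_domain :: "(real^'n::finite \<Rightarrow> real) \<Rightarrow> (real^'n) set \<Rightarrow> bool" where
  "smooth_bounded_domain psi \<Omega> \<longleftrightarrow>
     smooth_on UNIV psi \<and> \<Omega> = {x. psi x < 0} \<and> (\<forall>x. psi x = 0 \<longrightarrow> sgrad psi x \<noteq> 0) \<and>
     bounded \<Omega> \<and> connected \<Omega> \<and> \<Omega> \<noteq> {}"

definition normal :: "(real^'n::finite \<Rightarrow> real) \<Rightarrow> real^'n \<Rightarrow> real^'n" where
  "normal psi x = (1 / norm (sgrad psi x)) *\<^sub>R sgrad psi x"

definition dnormal :: "(real^'n::finite \<Rightarrow> real) \<Rightarrow> (real^'n \<Rightarrow> real) \<Rightarrow> real^'n \<Rightarrow> real" where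
  "dnormal psi f x = sgrad f x \<bullet> normal psi x"

definition zeta :: "real \<Rightarrow> real \<Rightarrow> real \<Rightarrow> real \<Rightarrow> real \<Rightarrow> real \<Rightarrow> phase \<Rightarrow> real \<Rightarrow> real" where
  "zeta Ag gg Al gl rl0 p0 k z =
     (case k of Gas \<Rightarrow> Ag * z powr gg
              | Liq \<Rightarrow> Al * (z powr gl - rl0 powr gl) + p0)"

definition pot_energy :: "(real \<Rightarrow> real) \<Rightarrow> real \<Rightarrow> real \<Rightarrow> real" where
  "pot_energy Z rref z = (LBINT s=ereal rref..ereal z. Z s / s\<^sup>2)"

end

theory Submission
  imports Defs
begin

text \<open>One time step is settled pointwise in \<Omega>, up to divergences of C1 fields with zero normal
  component on the boundary. Testing Step 4 with the intermediate velocity and using Step 1 gives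
  the kinetic, viscous and drag terms; Step 5, written as rhot ub + dt \<nabla>p' = rhot ut + dt \<nabla>pt
  (p' the new pressure) and squared, trades the work of \<nabla>pt for that of \<nabla>p'; Step 3 and Young's
  inequality bound \<nabla>pt by the old pressure gradient. The work of \<nabla>p' is the mass equation of
  Step 5 tested with the enthalpy e + p'/rho, and it dominates the increment of the potential energy
  because e is convex in 1/rho.

  The divergence theorem is only needed for fields F with F \<bullet> \<nabla>psi = 0 on the boundary. Then
  F \<bullet> \<nabla>psi = O(psi) inside \<Omega>, so the error made by a cutoff in psi is a bounded function that
  tends to 0 pointwise, and no surface measure enters.\<close>

subsection \<open>Partial derivatives and C1 fields\<close>

text \<open>No restriction on \<open>dt\<close> arises because everything discarded is nonnegative:
  a multiple of the squared jump between old and intermediate velocity, the square behind Young's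
  inequality, and the convexity gap of the potential energy. The root in Step 3 is the product of
  the old and the new value of \<open>sqrt (phit / rhot)\<close>, so Young's inequality returns the
  old pressure term with exactly its own weight; Step 6 makes the kinetic energy after the
  projection the one from which the next step starts. Hence the estimates telescope with constant
  one. The enthalpy is the right test function because its gradient is the pressure gradient over
  the density, which cancels the density in the flux of Step 5.

  Two features of the data shape the proof. The equation of state is given only in the open set
  \<Omega> and has to be differentiated there. Positivity is given only on the closure, so quotients
  and roots are C1 only on a smaller neighbourhood. The bound by psi comes from walking from an
  inner point in a fixed direction, along which psi grows at a definite rate, until the boundary is
  hit.\<close>

lemma pd_eqI: "(f has_derivative f') (at x) \<Longrightarrow> pd i f x = f' (axis i 1)"
  unfolding pd_def by (metis frechet_derivative_at)

lemma frechet_derivative_eq_sgrad: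
  fixes f :: "real^'n \<Rightarrow> real"
  assumes "f differentiable at x"
  shows "frechet_derivative f (at x) v = sgrad f x \<bullet> v"
proof -
  have lin: "linear (frechet_derivative f (at x))"
    using assms by (simp add: linear_frechet_derivative)
  have "frechet_derivative f (at x) v
      = frechet_derivative f (at x) (\<Sum>i\<in>UNIV. v $ i *\<^sub>R axis i 1)"
    using basis_expansion[of v] by (simp add: scalar_mult_eq_scaleR)
  also have "\<dots> = (\<Sum>i\<in>UNIV. v $ i * frechet_derivative f (at x) (axis i 1))"
    by (simp add: linear_sum[OF lin] linear_scale[OF lin])
  finally show ?thesis
    by (simp add: sgrad_def inner_vec_def pd_def mult.commute)
qed

lemma has_derivative_sgrad:
  fixes f :: "real^'n \<Rightarrow> real"
  assumes "f differentiable at x"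
  shows "(f has_derivative (\<lambda>v. sgrad f x \<bullet> v)) (at x)"
  using assms[unfolded frechet_derivative_works]
  by (simp add: frechet_derivative_eq_sgrad[OF assms, abs_def])

lemma DERIV_along_line:
  fixes f :: "real^'n \<Rightarrow> real"
  assumes "f differentiable at (x + t *\<^sub>R v)"
  shows "((\<lambda>t. f (x + t *\<^sub>R v)) has_real_derivative (sgrad f (x + t *\<^sub>R v) \<bullet> v)) (at t)"
proof -
  have "((\<lambda>t. x + t *\<^sub>R v) has_derivative (\<lambda>h. h *\<^sub>R v)) (at t)"
    by (auto intro!: derivative_eq_intros)
  from has_derivative_compose[OF this has_derivative_sgrad[OF assms]]
  show ?thesis unfolding has_field_derivative_def
    by (simp add: mult.commute[of _ "sgrad f (x + t *\<^sub>R v) \<bullet> v"])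
qed

text \<open>The derivative depends only on the germ of the function. This permits differentiating an
  identity known only in \<Omega>, such as the equation of state, and computing with functions
  defined by cases.\<close>

lemma pd_cong_open:
  assumes "open W" "x \<in> W" "\<And>y. y \<in> W \<Longrightarrow> f y = g y"
  shows "pd i f x = pd i g x"
proof -
  have *: "(f has_derivative D) (at x) = (g has_derivative D) (at x)" for D
    using has_derivative_transform_within_open[OF _ assms(1,2), of f D UNIV g]
      has_derivative_transform_within_open[OF _ assms(1,2), of g D UNIV f] assms(3) by auto
  show ?thesis by (simp add: pd_def frechet_derivative_def *)
qed

lemma pd_const: "pd i (\<lambda>y. c) x = 0"
  by (subst pd_eqI[where f'="\<lambda>_. 0"]) auto

lemma pd_add:
  assumes "f differentiable at x" "g differentiable at x"
  shows "pd i (\<lambda>y. f y + g y) x = pd i f x + pd i g x"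
  by (rule pd_eqI[THEN trans, OF has_derivative_add[OF assms[unfolded frechet_derivative_works]]])
    (simp add: pd_def)

lemma pd_diff:
  assumes "f differentiable at x" "g differentiable at x"
  shows "pd i (\<lambda>y. f y - g y) x = pd i f x - pd i g x"
  by (rule pd_eqI[THEN trans, OF has_derivative_diff[OF assms[unfolded frechet_derivative_works]]])
    (simp add: pd_def)

lemma pd_mult:
  assumes "f differentiable at x" "g differentiable at x"
  shows "pd i (\<lambda>y. f y * g y) x = f x * pd i g x + pd i f x * g x"
  by (rule pd_eqI[THEN trans, OF has_derivative_mult[OF assms[unfolded frechet_derivative_works]]])
    (simp add: pd_def)

lemma pd_sum:
  assumes "\<And>a. a \<in> S \<Longrightarrow> f a differentiable at x"
  shows "pd i (\<lambda>y. \<Sum>a\<in>S. f a y) x = (\<Sum>a\<in>S. pd i (f a) x)"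
proof -
  have "((\<lambda>y. \<Sum>a\<in>S. f a y) has_derivative (\<lambda>v. \<Sum>a\<in>S. frechet_derivative (f a) (at x) v)) (at x)"
    using assms by (intro has_derivative_sum) (simp add: frechet_derivative_works)
  from pd_eqI[OF this] show ?thesis by (simp add: pd_def)
qed

lemma has_derivative_compose_DERIV:
  fixes f :: "real^'n \<Rightarrow> real"
  assumes "f differentiable at x" "(g has_real_derivative D) (at (f x))"
  shows "((\<lambda>y. g (f y)) has_derivative (\<lambda>v. D * frechet_derivative f (at x) v)) (at x)"
  using has_derivative_compose[OF assms(1)[unfolded frechet_derivative_works]
      assms(2)[unfolded has_field_derivative_def]] .

lemma pd_compose:
  assumes "f differentiable at x" "(g has_real_derivative D) (at (f x))"
  shows "pd i (\<lambda>y. g (f y)) x = D * pd i f x"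
  by (rule pd_eqI[THEN trans, OF has_derivative_compose_DERIV[OF assms]]) (simp add: pd_def)

text \<open>Counterpart of \<open>Ck_on 1\<close> free of index lists; continuity of
  \<open>f\<close> itself follows from differentiability. The divergence theorem takes one
  derivative of a field, and the C2 hypotheses are spent on making gradients and stresses
  C1.\<close>

definition C1_on :: "(real^'n::finite) set \<Rightarrow> (real^'n \<Rightarrow> real) \<Rightarrow> bool" where
  "C1_on V f \<longleftrightarrow> (\<forall>x\<in>V. f differentiable at x) \<and> (\<forall>i. continuous_on V (pd i f))"

definition vC1_on :: "(real^'n::finite) set \<Rightarrow> (real^'n \<Rightarrow> real^'n) \<Rightarrow> bool" where
  "vC1_on V X \<longleftrightarrow> (\<forall>i. C1_on V (\<lambda>x. X x $ i))"

lemma C1_onD: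
  assumes "C1_on V f"
  shows "x \<in> V \<Longrightarrow> f differentiable at x" "continuous_on V (pd i f)" "continuous_on V f"
  using assms unfolding C1_on_def
  by (auto intro: continuous_at_imp_continuous_on differentiable_imp_continuous_within)

lemma vC1_onD: "vC1_on V X \<Longrightarrow> C1_on V (\<lambda>x. X x $ i)"
  by (simp add: vC1_on_def)

lemma C1_on_subset: "C1_on V f \<Longrightarrow> W \<subseteq> V \<Longrightarrow> C1_on W f"
  unfolding C1_on_def by (meson continuous_on_subset subsetD)

lemma vC1_on_subset: "vC1_on V f \<Longrightarrow> W \<subseteq> V \<Longrightarrow> vC1_on W f"
  unfolding vC1_on_def using C1_on_subset by blast

lemma Ck_on_2_imp_C1_on:
  assumes "Ck_on 2 V f"
  shows "C1_on V f" "C1_on V (pd i f)"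
proof -
  have d: "hpd is f differentiable at x" if "length is < 2" "x \<in> V" for "is" x
    using assms that unfolding Ck_on_def by blast
  have c: "continuous_on V (hpd is f)" if "length is \<le> 2" for "is"
    using assms that unfolding Ck_on_def by blast
  show "C1_on V f"
    unfolding C1_on_def using d[of "[]"] c[of "[_]"] by simp
  show "C1_on V (pd i f)"
    unfolding C1_on_def using d[of "[i]"] c[of "[_, i]"] by simp
qed

lemma C1_on_const: "C1_on V (\<lambda>x. c)"
  by (simp add: C1_on_def pd_const[abs_def])

lemma C1_on_add:
  assumes "C1_on V f" "C1_on V g" shows "C1_on V (\<lambda>x. f x + g x)"
  unfolding C1_on_def
proof (intro conjI ballI allI)
  show "(\<lambda>x. f x + g x) differentiable at x" if "x \<in> V" for x
    using assms that by (intro differentiable_add C1_onD(1))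
  show "continuous_on V (pd i (\<lambda>x. f x + g x))" for i
    by (subst continuous_on_cong[OF refl pd_add[OF assms[THEN C1_onD(1)]]])
      (intro continuous_intros assms C1_onD | assumption)+
qed

lemma C1_on_diff:
  assumes "C1_on V f" "C1_on V g" shows "C1_on V (\<lambda>x. f x - g x)"
  unfolding C1_on_def
proof (intro conjI ballI allI)
  show "(\<lambda>x. f x - g x) differentiable at x" if "x \<in> V" for x
    using assms that by (intro differentiable_diff C1_onD(1))
  show "continuous_on V (pd i (\<lambda>x. f x - g x))" for i
    by (subst continuous_on_cong[OF refl pd_diff[OF assms[THEN C1_onD(1)]]])
      (intro continuous_intros assms C1_onD | assumption)+
qed

lemma C1_on_mult:
  assumes "C1_on V f" "C1_on V g" shows "C1_on V (\<lambda>x. f x * g x)"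
  unfolding C1_on_def
proof (intro conjI ballI allI)
  show "(\<lambda>x. f x * g x) differentiable at x" if "x \<in> V" for x
    using assms that by (intro differentiable_mult C1_onD(1))
  show "continuous_on V (pd i (\<lambda>x. f x * g x))" for i
    by (subst continuous_on_cong[OF refl pd_mult[OF assms[THEN C1_onD(1)]]])
      (intro continuous_intros assms C1_onD | assumption)+
qed

lemma C1_on_sum:
  assumes "\<And>a. a \<in> S \<Longrightarrow> C1_on V (f a)" shows "C1_on V (\<lambda>x. \<Sum>a\<in>S. f a x)"
proof (cases "finite S")
  case True
  then show ?thesis using assms
    by (induction S) (auto intro: C1_on_const C1_on_add)
qed (simp add: C1_on_const)

text \<open>The conditions on \<open>g\<close> are confined to the image of \<open>f\<close>, since
  the outer functions in use (inverse, square root, enthalpy) are singular at 0.\<close>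

lemma C1_on_compose:
  assumes f: "C1_on V f"
    and g: "\<And>x. x \<in> V \<Longrightarrow> (g has_real_derivative g' (f x)) (at (f x))"
    and c: "continuous_on (f ` V) g'"
  shows "C1_on V (\<lambda>x. g (f x))"
proof -
  have "continuous_on V (\<lambda>x. g' (f x))"
    using continuous_on_compose2[OF c C1_onD(3)[OF f]] by blast
  moreover have "(\<lambda>x. g (f x)) differentiable at x" if "x \<in> V" for x
    using has_derivative_compose_DERIV[where f=f and g=g, OF _ g[OF that]] f that
    unfolding C1_on_def differentiable_def by blast
  moreover have "continuous_on V (pd i (\<lambda>x. g (f x)))" for i
    by (subst continuous_on_cong[OF refl pd_compose[where f=f and g=g, OF C1_onD(1)[OF f] g]])
      (intro continuous_intros calculation C1_onD f | assumption)+
  ultimately show ?thesis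
    unfolding C1_on_def by blast
qed

lemma C1_on_inverse:
  assumes "C1_on V f" "\<And>x. x \<in> V \<Longrightarrow> f x \<noteq> 0"
  shows "C1_on V (\<lambda>x. inverse (f x))"
proof (rule C1_on_compose[OF assms(1)])
  show "(inverse has_real_derivative - (inverse (f x) ^ 2)) (at (f x))" if "x \<in> V" for x
    using DERIV_inverse[of "f x"] assms(2)[OF that] by (simp add: numeral_2_eq_2)
  have "\<forall>z\<in>f ` V. z \<noteq> 0" using assms(2) by auto
  then show "continuous_on (f ` V) (\<lambda>z. - (inverse z ^ 2))"
    by (intro continuous_intros)
qed

lemma C1_on_divide:
  assumes "C1_on V f" "C1_on V g" "\<And>x. x \<in> V \<Longrightarrow> g x \<noteq> 0"
  shows "C1_on V (\<lambda>x. f x / g x)"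
  unfolding divide_inverse using assms by (intro C1_on_mult C1_on_inverse)

lemma C1_on_sqrt:
  assumes "C1_on V f" "\<And>x. x \<in> V \<Longrightarrow> f x > 0"
  shows "C1_on V (\<lambda>x. sqrt (f x))"
proof (rule C1_on_compose[OF assms(1)])
  show "(sqrt has_real_derivative inverse (sqrt (f x)) / 2) (at (f x))" if "x \<in> V" for x
    using DERIV_real_sqrt[of "f x"] assms(2)[OF that] by simp
  have "\<forall>z\<in>f ` V. sqrt z \<noteq> 0" using assms(2) by force
  then show "continuous_on (f ` V) (\<lambda>z. inverse (sqrt z) / 2)"
    by (intro continuous_intros) auto
qed

lemma vC1_on_scaleR:
  "C1_on V f \<Longrightarrow> vC1_on V X \<Longrightarrow> vC1_on V (\<lambda>x. f x *\<^sub>R X x)"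
  unfolding vC1_on_def by (auto intro: C1_on_mult)

lemma vC1_on_diff:
  "vC1_on V X \<Longrightarrow> vC1_on V Y \<Longrightarrow> vC1_on V (\<lambda>x. X x - Y x)"
  unfolding vC1_on_def by (auto intro: C1_on_diff)

lemma vC1_on_sgrad: "Ck_on 2 V f \<Longrightarrow> vC1_on V (sgrad f)"
  by (simp add: vC1_on_def sgrad_def Ck_on_2_imp_C1_on)

lemma C1_on_inner:
  "vC1_on V X \<Longrightarrow> vC1_on V Y \<Longrightarrow> C1_on V (\<lambda>x. X x \<bullet> Y x)"
  unfolding inner_vec_def vC1_on_def by (auto intro!: C1_on_sum C1_on_mult)

lemma vC1_on_continuous: "vC1_on V X \<Longrightarrow> continuous_on V X"
  using continuous_on_vec_lambda[of V "\<lambda>i x. X x $ i"] by (simp add: vC1_on_def C1_onD(3))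

lemma continuous_on_sgrad: "C1_on V f \<Longrightarrow> continuous_on V (sgrad f)"
  unfolding sgrad_def by (intro continuous_on_vec_lambda C1_onD(2))

lemma continuous_on_vdiv: "vC1_on V X \<Longrightarrow> continuous_on V (vdiv X)"
  unfolding vdiv_def[abs_def] vC1_on_def by (intro continuous_intros C1_onD(2)) auto

lemma vdiv_scaleR:
  assumes "C1_on V f" "vC1_on V X" "x \<in> V"
  shows "vdiv (\<lambda>y. f y *\<^sub>R X y) x = f x * vdiv X x + sgrad f x \<bullet> X x"
proof -
  have "f differentiable at x" "\<And>i. (\<lambda>y. X y $ i) differentiable at x"
    using assms C1_onD(1) unfolding vC1_on_def by blast+
  then show ?thesis
    by (simp add: vdiv_def pd_mult sum.distrib sum_distrib_left inner_vec_def sgrad_def)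
qed

lemma vdiv_diff:
  assumes "vC1_on V X" "vC1_on V Y" "x \<in> V"
  shows "vdiv (\<lambda>y. X y - Y y) x = vdiv X x - vdiv Y x"
proof -
  have "\<And>i. (\<lambda>y. X y $ i) differentiable at x" "\<And>i. (\<lambda>y. Y y $ i) differentiable at x"
    using assms C1_onD(1) unfolding vC1_on_def by blast+
  then show ?thesis
    by (simp add: vdiv_def pd_diff sum_subtractf)
qed

subsection \<open>The divergence theorem for tangential fields\<close>

text \<open>By translation invariance of Lebesgue measure every difference quotient of
  \<open>f\<close> has integral 0; the mean value theorem bounds the quotients by \<open>B\<close>,
  and dominated convergence passes to the partial derivative.\<close>

lemma integral_pd_compact_support:
  fixes f :: "real^'n \<Rightarrow> real"
  assumes diff: "\<And>x. f differentiable at x"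
    and bd: "\<And>x. \<bar>pd i f x\<bar> \<le> B"
    and supp: "\<And>x. f x \<noteq> 0 \<Longrightarrow> norm x \<le> R"
  shows "integrable lborel (pd i f)" "integral\<^sup>L lborel (pd i f) = 0"
proof -
  define e :: "real^'n" where "e = axis i 1"
  \<comment> \<open>Increments of length at most 1 keep all quotients supported in the ball of
    radius \<open>R + 1\<close>.\<close>
  define s where "s k = inverse (real (Suc k))" for k
  define q where "q k x = (f (x + s k *\<^sub>R e) - f x) / s k" for k x
  have s: "0 < s k" "s k \<le> 1" for k by (auto simp: s_def field_simps)
  have ne: "norm e = 1" by (simp add: e_def)
  have B: "0 \<le> B" using bd[of 0] by linarith
  have contf: "continuous_on UNIV f"
    using diff by (simp add: continuous_at_imp_continuous_on differentiable_imp_continuous_within)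
  have "(\<lambda>x. indicator (cball 0 R) x *\<^sub>R f x) = f"
    using supp by (auto simp: indicator_def fun_eq_iff)
  moreover have "integrable lborel (\<lambda>x. indicator (cball 0 R) x *\<^sub>R f x)"
    using contf by (intro borel_integrable_compact) (auto intro: continuous_on_subset)
  ultimately have intf: "integrable lborel f" by metis
  have intf': "integrable lborel (\<lambda>x. f (x + s k *\<^sub>R e))"
    and eqf: "(\<integral>x. f (x + s k *\<^sub>R e) \<partial>lborel) = integral\<^sup>L lborel f" for k
  proof -
    have tr: "lborel = distr lborel borel (\<lambda>x. x + s k *\<^sub>R e)"
      unfolding add.commute[of _ "s k *\<^sub>R e"] by (rule lborel_distr_plus[symmetric])
    have m: "(\<lambda>x. x + s k *\<^sub>R e) \<in> measurable lborel borel" by measurable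
    have fm: "f \<in> borel_measurable borel" using contf by (rule borel_measurable_continuous_onI)
    show "integrable lborel (\<lambda>x. f (x + s k *\<^sub>R e))"
      using intf integrable_distr_eq[OF m fm] tr by simp
    show "(\<integral>x. f (x + s k *\<^sub>R e) \<partial>lborel) = integral\<^sup>L lborel f"
      using integral_distr[OF m fm] tr by simp
  qed
  have q0: "integral\<^sup>L lborel (q k) = 0" for k
    unfolding q_def using intf intf' eqf by simp
  have qm: "q k \<in> borel_measurable lborel" for k
    unfolding q_def using intf intf'[of k] by measurable
  have pde: "sgrad f y \<bullet> e = pd i f y" for y
    by (simp add: e_def sgrad_def inner_axis)
  have line: "((\<lambda>t. f (x + t *\<^sub>R e)) has_real_derivative pd i f (x + t *\<^sub>R e)) (at t)" for x t
    using DERIV_along_line[of f x t e, OF diff] by (simp add: pde)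
  have qlim: "(\<lambda>k. q k x) \<longlonglongrightarrow> pd i f x" for x
  proof -
    have "((\<lambda>h. (f (x + h *\<^sub>R e) - f x) / h) \<longlongrightarrow> pd i f x) (at 0)"
      using line[of x 0] by (simp add: DERIV_def)
    moreover have "filterlim s (at 0) sequentially"
    proof -
      have "s \<longlonglongrightarrow> 0" unfolding s_def[abs_def] by (rule LIMSEQ_inverse_real_of_nat)
      then show ?thesis
        unfolding filterlim_at using s(1) by (auto intro!: always_eventually simp: less_imp_neq[symmetric])
    qed
    ultimately show ?thesis unfolding q_def by (rule filterlim_compose)
  qed
  have qbd: "norm (q k x) \<le> indicator (cball 0 (R + 1)) x *\<^sub>R B" for k x
  proof (cases "norm x \<le> R + 1")
    case True
    obtain t where t: "f (x + s k *\<^sub>R e) - f (x + 0 *\<^sub>R e) = (s k - 0) * pd i f (x + t *\<^sub>R e)"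
      using MVT2[OF s(1)[of k] line[of x]] by blast
    then have "q k x = pd i f (x + t *\<^sub>R e)" using s(1)[of k] by (simp add: q_def)
    then show ?thesis using True bd by simp
  next
    case False
    have "norm x \<le> norm (x + s k *\<^sub>R e) + norm (s k *\<^sub>R e)"
      using norm_triangle_ineq4[of "x + s k *\<^sub>R e" "s k *\<^sub>R e"] by simp
    then have "norm (x + s k *\<^sub>R e) > R" using False s[of k] ne by simp
    then have "f (x + s k *\<^sub>R e) = 0" "f x = 0" using supp False by force+
    then show ?thesis by (simp add: q_def B)
  qed
  \<comment> \<open>\<open>pd i f\<close> is bounded but possibly discontinuous; its measurability
    is inherited from the quotients.\<close>
  have pm: "pd i f \<in> borel_measurable lborel"
    using borel_measurable_LIMSEQ_real[OF qlim qm] by simp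
  have iw: "integrable lborel (\<lambda>x. indicator (cball 0 (R + 1)) x *\<^sub>R B)"
    by (intro borel_integrable_compact) auto
  show "integrable lborel (pd i f)"
    by (rule integrable_dominated_convergence[where s=q, OF pm qm iw]) (use qlim qbd in auto)
  have "(\<lambda>k. integral\<^sup>L lborel (q k)) \<longlonglongrightarrow> integral\<^sup>L lborel (pd i f)"
    by (rule integral_dominated_convergence[where s=q, OF pm qm iw]) (use qlim qbd in auto)
  then show "integral\<^sup>L lborel (pd i f) = 0"
    by (simp add: q0 LIMSEQ_const_iff)
qed

section \<open>Functions vanishing on the boundary are O(psi)\<close>

lemma smooth_bounded_domainD:
  assumes "smooth_bounded_domain psi \<Omega>"
  shows "Ck_on 2 UNIV psi" "\<Omega> = {x. psi x < 0}" "open \<Omega>" "bounded \<Omega>" "compact (closure \<Omega>)"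
    "x \<in> frontier \<Omega> \<Longrightarrow> psi x = 0" "x \<in> frontier \<Omega> \<Longrightarrow> sgrad psi x \<noteq> 0"
proof -
  show 1: "Ck_on 2 UNIV psi" and 2: "\<Omega> = {x. psi x < 0}" and 3: "bounded \<Omega>"
    using assms unfolding smooth_bounded_domain_def smooth_on_def by auto
  have cont: "continuous_on UNIV psi" using Ck_on_2_imp_C1_on(1)[OF 1] C1_onD(3) by blast
  show 4: "open \<Omega>" unfolding 2 by (intro open_Collect_less cont continuous_intros)
  show "compact (closure \<Omega>)" using 3 by simp
  have "closed {x. psi x \<le> 0}" by (intro closed_Collect_le cont continuous_intros)
  then have "closure \<Omega> \<subseteq> {x. psi x \<le> 0}" unfolding 2 by (intro closure_minimal) auto
  then show "psi x = 0" if "x \<in> frontier \<Omega>"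
    using that 4 unfolding 2 frontier_def by (auto simp: interior_open)
  then show "sgrad psi x \<noteq> 0" if "x \<in> frontier \<Omega>"
    using that assms unfolding smooth_bounded_domain_def by blast
qed

text \<open>Near \<open>x0\<close> the function \<open>psi\<close> grows at rate at least
  \<open>c\<close> in the direction \<open>nu\<close>, so a line from \<open>x\<close> in this
  direction meets the boundary within time \<open>\<bar>psi x\<bar> / c\<close>. There
  \<open>g\<close> vanishes, and on the way it changes at rate at most \<open>L\<close>, which gives
  the constant \<open>L / c\<close>.\<close>

lemma vanishing_on_frontier_local_bound:
  assumes dom: "smooth_bounded_domain psi \<Omega>"
    and V: "open V" "closure \<Omega> \<subseteq> V" and g: "C1_on V g"
    and g0: "\<And>x. x \<in> frontier \<Omega> \<Longrightarrow> g x = 0"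
    and x0: "x0 \<in> frontier \<Omega>"
  shows "\<exists>r>0. \<exists>C. \<forall>x\<in>ball x0 r \<inter> \<Omega>. \<bar>g x\<bar> \<le> C * \<bar>psi x\<bar>"
proof -
  note D = smooth_bounded_domainD[OF dom]
  have psi1: "C1_on UNIV psi" using D(1) by (rule Ck_on_2_imp_C1_on)
  have psic: "continuous_on UNIV psi" using psi1 by (rule C1_onD)
  define nu where "nu = sgrad psi x0 /\<^sub>R norm (sgrad psi x0)"
  \<comment> \<open>Half the gradient norm: the slope of \<open>psi\<close> along \<open>nu\<close>
    is \<open>2 * c\<close> at \<open>x0\<close> and stays above \<open>c\<close> nearby.\<close>
  define c where "c = norm (sgrad psi x0) / 2"
  have n0: "norm (sgrad psi x0) > 0" using D(7)[OF x0] by simp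
  then have c0: "c > 0" by (simp add: c_def)
  have nnu: "norm nu = 1" using n0 by (simp add: nu_def)
  have "sgrad psi x0 \<bullet> nu = 2 * c"
    using n0 by (simp add: nu_def c_def dot_square_norm power2_eq_square)
  moreover have "continuous_on UNIV (\<lambda>y. sgrad psi y \<bullet> nu)"
    by (intro continuous_intros continuous_on_sgrad psi1)
  ultimately have "open {y. sgrad psi y \<bullet> nu > c} \<and> x0 \<in> {y. sgrad psi y \<bullet> nu > c}"
    using c0 by (auto intro!: open_Collect_less continuous_intros)
  moreover have "x0 \<in> V" using x0 V(2) by (auto simp: frontier_def)
  ultimately have "open ({y. sgrad psi y \<bullet> nu > c} \<inter> V)" "x0 \<in> {y. sgrad psi y \<bullet> nu > c} \<inter> V"
    using V(1) by auto
  then obtain R where R: "R > 0" "cball x0 R \<subseteq> {y. sgrad psi y \<bullet> nu > c} \<inter> V"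
    using open_contains_cball by blast
  have "continuous_on (cball x0 R) (\<lambda>y. sgrad g y \<bullet> nu)"
    using R(2) by (intro continuous_intros continuous_on_subset[OF continuous_on_sgrad[OF g]]) auto
  then have "bounded ((\<lambda>y. sgrad g y \<bullet> nu) ` cball x0 R)"
    by (intro compact_imp_bounded compact_continuous_image) auto
  then obtain L where L: "\<And>y. y \<in> cball x0 R \<Longrightarrow> \<bar>sgrad g y \<bullet> nu\<bar> \<le> L"
    unfolding bounded_iff by (metis imageI real_norm_def)
  have "L \<ge> 0" using L[of x0] R(1) by (smt (verit) centre_in_cball)
  \<comment> \<open>Within distance \<open>d\<close> of \<open>x0\<close> the travel time
    \<open>\<bar>psi x\<bar> / c\<close> is below \<open>R / 2\<close>, so a path that starts within
    \<open>R / 2\<close> of \<open>x0\<close> stays in \<open>cball x0 R\<close>.\<close>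
  have "\<exists>d>0. \<forall>x. dist x x0 < d \<longrightarrow> dist (psi x) (psi x0) < c * (R / 2)"
    using psic c0 R(1) unfolding continuous_on_iff by (metis UNIV_I half_gt_zero mult_pos_pos)
  then obtain d where d: "d > 0" "\<And>x. dist x x0 < d \<Longrightarrow> \<bar>psi x\<bar> < c * (R / 2)"
    using D(6)[OF x0] by (auto simp: dist_real_def)
  show ?thesis
  proof (intro exI conjI ballI)
    show "min d (R / 2) > 0" using d R by simp
    fix x assume x: "x \<in> ball x0 (min d (R / 2)) \<inter> \<Omega>"
    define T where "T = \<bar>psi x\<bar> / c"
    have px: "psi x < 0" using x D(2) by auto
    have T: "0 < T" "T < R / 2" using px c0 d(2)[of x] x
      by (auto simp: T_def field_simps dist_commute)
    have inb: "x + t *\<^sub>R nu \<in> cball x0 R" if "0 \<le> t" "t \<le> T" for t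
    proof -
      have "dist x0 (x + t *\<^sub>R nu) \<le> dist x0 x + norm (t *\<^sub>R nu)"
        by (metis dist_norm dist_triangle add_diff_cancel_left' dist_commute)
      then show ?thesis using x that T nnu by auto
    qed
    have dpsi: "((\<lambda>t. psi (x + t *\<^sub>R nu)) has_real_derivative sgrad psi (x + t *\<^sub>R nu) \<bullet> nu) (at t)" for t
      by (intro DERIV_along_line C1_onD(1)[OF psi1]) auto
    obtain t1 where t1: "0 < t1" "t1 < T"
      "psi (x + T *\<^sub>R nu) - psi (x + 0 *\<^sub>R nu) = (T - 0) * (sgrad psi (x + t1 *\<^sub>R nu) \<bullet> nu)"
      using MVT2[OF T(1) dpsi] by blast
    have "sgrad psi (x + t1 *\<^sub>R nu) \<bullet> nu \<ge> c"
      using inb[of t1] t1 R(2) by (auto simp: less_imp_le)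
    then have "T * (sgrad psi (x + t1 *\<^sub>R nu) \<bullet> nu) \<ge> T * c"
      using T by (intro mult_left_mono) auto
    moreover have "T * c = - psi x" using c0 px by (simp add: T_def)
    ultimately have pT: "psi (x + T *\<^sub>R nu) \<ge> 0" using t1(3) by simp
    have cl: "continuous_on {0..T} (\<lambda>t. psi (x + t *\<^sub>R nu))"
      by (intro continuous_on_compose2[OF psic] continuous_intros) auto
    \<comment> \<open>The first time at which \<open>psi\<close> is nonnegative is chosen: all
      earlier points lie in \<Omega>, which places the hitting point in
      \<open>frontier \<Omega>\<close>, where \<open>g0\<close> applies.\<close>
    define S where "S = {t \<in> {0..T}. psi (x + t *\<^sub>R nu) \<ge> 0}"
    have "closed S" unfolding S_def
      using continuous_on_closed_Collect_le[OF continuous_on_const[of "{0..T}" 0] cl] by simp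
    moreover have "S \<noteq> {}" "bdd_below S" using pT T by (auto simp: S_def intro!: bdd_belowI[of _ 0])
    ultimately have "Inf S \<in> S" by (intro closed_contains_Inf)
    define t where "t = Inf S"
    have tS: "t \<in> {0..T}" "psi (x + t *\<^sub>R nu) \<ge> 0"
      using \<open>Inf S \<in> S\<close> by (auto simp: t_def S_def)
    have below: "psi (x + s *\<^sub>R nu) < 0" if "0 \<le> s" "s < t" for s
    proof (rule ccontr)
      assume "\<not> ?thesis"
      then have "s \<in> S" using that tS by (auto simp: S_def)
      then have "t \<le> s" unfolding t_def using \<open>bdd_below S\<close> by (rule cInf_lower)
      then show False using that by simp
    qed
    have t0: "0 < t" using tS px by (cases "t = 0") auto
    have "x + t *\<^sub>R nu \<in> closure \<Omega>"
    proof -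
      have "((\<lambda>s. x + s *\<^sub>R nu) \<longlongrightarrow> x + t *\<^sub>R nu) (at_left t)"
        by (intro tendsto_intros)
      moreover have "eventually (\<lambda>s. x + s *\<^sub>R nu \<in> \<Omega>) (at_left t)"
        using eventually_at_left_real[OF t0] by eventually_elim (auto simp: D(2) below)
      ultimately show ?thesis
        by (intro Lim_in_closed_set[of "closure \<Omega>" "\<lambda>s. x + s *\<^sub>R nu" "at_left t"])
          (auto elim: eventually_mono intro: closure_subset[THEN subsetD])
    qed
    moreover have "x + t *\<^sub>R nu \<notin> \<Omega>" using tS by (auto simp: D(2))
    ultimately have "x + t *\<^sub>R nu \<in> frontier \<Omega>" using D(3) by (simp add: frontier_def interior_open)
    then have gt: "g (x + t *\<^sub>R nu) = 0" by (rule g0)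
    have pt0: "psi (x + t *\<^sub>R nu) = 0" using \<open>x + t *\<^sub>R nu \<in> frontier \<Omega>\<close> by (rule D(6))
    have "((\<lambda>t. g (x + t *\<^sub>R nu)) has_real_derivative sgrad g (x + s *\<^sub>R nu) \<bullet> nu) (at s)"
      if "0 \<le> s" "s \<le> t" for s
      using inb[of s] that tS R(2) by (intro DERIV_along_line C1_onD(1)[OF g]) auto
    then obtain t2 where t2: "0 < t2" "t2 < t"
      "g (x + t *\<^sub>R nu) - g (x + 0 *\<^sub>R nu) = (t - 0) * (sgrad g (x + t2 *\<^sub>R nu) \<bullet> nu)"
      using MVT2[OF t0, of "\<lambda>t. g (x + t *\<^sub>R nu)" "\<lambda>s. sgrad g (x + s *\<^sub>R nu) \<bullet> nu"] by blast
    have "\<bar>g x\<bar> = t * \<bar>sgrad g (x + t2 *\<^sub>R nu) \<bullet> nu\<bar>"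
      using t2(3) gt t0 by (simp add: abs_mult[symmetric] abs_minus_commute) (metis abs_minus_cancel abs_mult abs_of_pos)
    also have "\<dots> \<le> T * L"
      using L[of "x + t2 *\<^sub>R nu"] inb[of t2] t2 tS T \<open>L \<ge> 0\<close> by (intro mult_mono) auto
    finally show "\<bar>g x\<bar> \<le> (L / c) * \<bar>psi x\<bar>" by (simp add: T_def mult.commute)
  qed
qed

text \<open>Compactness of the closure globalises the local bound. Around an inner point
  \<open>g / psi\<close> is continuous on a small closed ball and hence bounded; the sum of the
  local constants over a finite subcover serves everywhere.\<close>

lemma vanishing_on_frontier_bound:
  assumes dom: "smooth_bounded_domain psi \<Omega>"
    and V: "open V" "closure \<Omega> \<subseteq> V" and g: "C1_on V g"
    and g0: "\<And>x. x \<in> frontier \<Omega> \<Longrightarrow> g x = 0"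
  shows "\<exists>C\<ge>0. \<forall>x\<in>\<Omega>. \<bar>g x\<bar> \<le> C * \<bar>psi x\<bar>"
proof -
  note D = smooth_bounded_domainD[OF dom]
  have psic: "continuous_on UNIV psi" using D(1) by (intro C1_onD Ck_on_2_imp_C1_on)
  have loc: "\<exists>r>0. \<exists>C. \<forall>x\<in>ball x0 r \<inter> \<Omega>. \<bar>g x\<bar> \<le> C * \<bar>psi x\<bar>" if "x0 \<in> closure \<Omega>" for x0
  proof (cases "x0 \<in> \<Omega>")
    case True
    then obtain r where r: "r > 0" "cball x0 r \<subseteq> \<Omega>" using D(3) open_contains_cball by blast
    have "continuous_on (cball x0 r) (\<lambda>x. g x / psi x)"
      using r(2) V(2) closure_subset[of \<Omega>] D(2)
      by (intro continuous_intros continuous_on_subset[OF C1_onD(3)[OF g]]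
          continuous_on_subset[OF psic]) auto
    then have "bounded ((\<lambda>x. g x / psi x) ` cball x0 r)"
      by (intro compact_imp_bounded compact_continuous_image) auto
    then obtain C where C: "\<And>y. y \<in> cball x0 r \<Longrightarrow> \<bar>g y / psi y\<bar> \<le> C"
      unfolding bounded_iff by (metis imageI real_norm_def)
    have "\<bar>g y\<bar> \<le> C * \<bar>psi y\<bar>" if "y \<in> ball x0 r \<inter> \<Omega>" for y
      using C[of y] that D(2) by (auto simp: field_simps split: if_splits)
    then show ?thesis using r(1) by blast
  next
    case False
    then have "x0 \<in> frontier \<Omega>" using that D(3) by (simp add: frontier_def interior_open)
    from vanishing_on_frontier_local_bound[OF dom V g g0 this] show ?thesis by blast
  qed
  then obtain r C where rC: "\<And>x0. x0 \<in> closure \<Omega> \<Longrightarrow> r x0 > 0 \<and> (\<forall>x\<in>ball x0 (r x0) \<inter> \<Omega>. \<bar>g x\<bar> \<le> C x0 * \<bar>psi x\<bar>)"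
    by metis
  obtain S where S: "S \<subseteq> closure \<Omega>" "finite S" "closure \<Omega> \<subseteq> (\<Union>x0\<in>S. ball x0 (r x0))"
    by (rule compactE_image[OF D(5), of "closure \<Omega>" "\<lambda>x0. ball x0 (r x0)"]) (use rC in force)+
  show ?thesis
  proof (intro exI conjI ballI)
    show "0 \<le> (\<Sum>x0\<in>S. \<bar>C x0\<bar>)" by (simp add: sum_nonneg)
    fix x assume x: "x \<in> \<Omega>"
    then obtain x0 where x0: "x0 \<in> S" "x \<in> ball x0 (r x0)" using S(3) closure_subset by blast
    then have "\<bar>g x\<bar> \<le> C x0 * \<bar>psi x\<bar>" using rC S(1) x by blast
    also have "\<dots> \<le> (\<Sum>x0\<in>S. \<bar>C x0\<bar>) * \<bar>psi x\<bar>"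
      using member_le_sum[of x0 S "\<lambda>x0. \<bar>C x0\<bar>"] S(2) x0(1)
      by (intro mult_right_mono) auto
    finally show "\<bar>g x\<bar> \<le> (\<Sum>x0\<in>S. \<bar>C x0\<bar>) * \<bar>psi x\<bar>" .
  qed
qed

text \<open>A C1 cutoff in the value s of the defining function, supported in s \<le> -1/c. What matters is
  that s times its derivative stays bounded uniformly in c and tends to 0 as c \<rightarrow> \<infinity>.\<close>
definition cutoff :: "real \<Rightarrow> real \<Rightarrow> real" where
  "cutoff c s = (max 0 (1 + 1 / (c * s)))\<^sup>2"

definition cutoff' :: "real \<Rightarrow> real \<Rightarrow> real" where
  "cutoff' c s = 2 * max 0 (1 + 1 / (c * s)) * (- 1 / (c * s\<^sup>2))"

text \<open>Squaring removes the corner of the positive part at 0, which is why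
  \<open>cutoff\<close> is a square.\<close>

lemma DERIV_max_0_square: "((\<lambda>t::real. (max 0 t)\<^sup>2) has_real_derivative 2 * max 0 t) (at t)"
proof -
  consider "t < 0" | "t > 0" | "t = 0" by linarith
  then show ?thesis
  proof cases
    case 1
    have "((\<lambda>t::real. 0) has_real_derivative 2 * max 0 t) (at t)" using 1 by simp
    then show ?thesis
      by (rule has_field_derivative_transform_within_open[where S="{..<0}"]) (use 1 in auto)
  next
    case 2
    have "((\<lambda>t::real. t\<^sup>2) has_real_derivative 2 * max 0 t) (at t)"
      using 2 by (auto intro!: derivative_eq_intros)
    then show ?thesis
      by (rule has_field_derivative_transform_within_open[where S="{0<..}"]) (use 2 in auto)
  next
    case 3
    have "((\<lambda>h::real. (max 0 h)\<^sup>2 / h) \<longlongrightarrow> 0) (at 0)"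
    proof (rule tendsto_rabs_zero_cancel, rule tendsto_sandwich)
      show "eventually (\<lambda>h::real. 0 \<le> \<bar>(max 0 h)\<^sup>2 / h\<bar>) (at 0)" by simp
      show "eventually (\<lambda>h::real. \<bar>(max 0 h)\<^sup>2 / h\<bar> \<le> \<bar>h\<bar>) (at 0)"
        by (intro always_eventually) (auto simp: max_def power2_eq_square)
      show "((\<lambda>h::real. \<bar>h\<bar>) \<longlongrightarrow> 0) (at 0)" by (intro tendsto_rabs_zero tendsto_ident_at)
    qed simp
    then show ?thesis using 3 by (simp add: DERIV_def)
  qed
qed

lemma DERIV_cutoff:
  assumes "c > 0" "s < 0"
  shows "(cutoff c has_real_derivative cutoff' c s) (at s)"
proof -
  have "((\<lambda>s. 1 + 1 / (c * s)) has_real_derivative (- 1 / (c * s\<^sup>2))) (at s)"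
    using assms by (auto intro!: derivative_eq_intros simp: power2_eq_square field_simps)
  from DERIV_chain2[OF DERIV_max_0_square this] show ?thesis
    unfolding cutoff_def[abs_def] cutoff'_def .
qed

text \<open>On this strip \<open>c * s\<close> lies between -1 and 0, so \<open>1 / (c * s)\<close>
  is below -1. Because of the strip, a product with the cutoff extends by zero across the boundary
  as a differentiable function.\<close>

lemma cutoff_eq_0: "c > 0 \<Longrightarrow> - 1 / c < s \<Longrightarrow> s < 0 \<Longrightarrow> cutoff c s = 0"
proof -
  assume c: "c > 0" "- 1 / c < s" "s < 0"
  then have "c * s < 0" "- 1 < c * s"
    using mult_strict_left_mono[OF c(2,1)] by (auto simp: mult_pos_neg)
  then have "1 / (c * s) < - 1" by (simp add: neg_divide_less_eq)
  then show ?thesis by (simp add: cutoff_def max_def)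
qed

text \<open>Where the derivative is nonzero, \<open>c * \<bar>s\<bar>\<close> exceeds 1, and
  \<open>s * cutoff' c s\<close> equals \<open>2 * a / (c * (- s))\<close>. The bound 2 is uniform
  in \<open>c\<close> and provides the dominating function in the limit; the bound
  \<open>2 * c\<close> serves for one fixed cutoff.\<close>

lemma cutoff_bounds:
  assumes "c > 0" "s < 0"
  shows "\<bar>cutoff c s\<bar> \<le> 1" "\<bar>s * cutoff' c s\<bar> \<le> 2" "\<bar>cutoff' c s\<bar> \<le> 2 * c"
proof -
  define a where "a = max 0 (1 + 1 / (c * s))"
  have a: "0 \<le> a" "a \<le> 1"
    using divide_pos_neg[OF zero_less_one mult_pos_neg[OF assms]] by (auto simp: a_def)
  have "\<bar>a ^ 2\<bar> \<le> 1" using a by (simp add: abs_square_le_1)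
  then show "\<bar>cutoff c s\<bar> \<le> 1" by (simp add: cutoff_def a_def)
  have cs: "cutoff' c s = - (2 * a / (c * s\<^sup>2))" by (simp add: cutoff'_def a_def)
  have "\<bar>s * cutoff' c s\<bar> \<le> 2 \<and> \<bar>cutoff' c s\<bar> \<le> 2 * c"
  proof (cases "a = 0")
    case True
    then show ?thesis using cs assms by simp
  next
    case False
    then have "1 + 1 / (c * s) > 0" by (auto simp: a_def max_def split: if_splits)
    then have "- 1 < 1 / (c * s)" by simp
    then have k: "1 < c * (- s)"
      using neg_less_divide_eq[OF mult_pos_neg[OF assms], of "- 1" 1] by simp
    have "s * cutoff' c s = 2 * a / (c * (- s))"
      unfolding cs using assms by (simp add: field_simps power2_eq_square)
    moreover have "2 * a / (c * (- s)) \<le> 2"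
      by (subst pos_divide_le_eq) (use k a in auto)
    moreover have "2 * a / (c * (- s)) \<ge> 0"
      by (intro divide_nonneg_pos) (use k a in auto)
    ultimately have 1: "\<bar>s * cutoff' c s\<bar> \<le> 2" by simp
    have "1 \<le> c * \<bar>s\<bar>" using k assms by auto
    then have "\<bar>cutoff' c s\<bar> * 1 \<le> \<bar>cutoff' c s\<bar> * (c * \<bar>s\<bar>)"
      by (intro mult_left_mono) auto
    also have "\<dots> = \<bar>s * cutoff' c s\<bar> * c" by (simp add: abs_mult)
    also have "\<dots> \<le> 2 * c" using 1 assms by (intro mult_right_mono) auto
    finally show ?thesis using 1 by simp
  qed
  then show "\<bar>s * cutoff' c s\<bar> \<le> 2" "\<bar>cutoff' c s\<bar> \<le> 2 * c" by auto
qed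

lemma cutoff_limits:
  assumes "s < 0"
  shows "(\<lambda>n. cutoff (real (Suc n)) s) \<longlonglongrightarrow> 1" "(\<lambda>n. cutoff' (real (Suc n)) s) \<longlonglongrightarrow> 0"
proof -
  have i: "(\<lambda>n. inverse (real (Suc n))) \<longlonglongrightarrow> 0" by (rule LIMSEQ_inverse_real_of_nat)
  have a: "(\<lambda>n. max 0 (1 + inverse (real (Suc n)) * inverse s)) \<longlonglongrightarrow> max 0 (1 + 0 * inverse s)"
    by (intro tendsto_intros i)
  have "(\<lambda>n. (max 0 (1 + inverse (real (Suc n)) * inverse s))\<^sup>2) \<longlonglongrightarrow> (max 0 (1 + 0 * inverse s))\<^sup>2"
    by (intro tendsto_power a)
  then show "(\<lambda>n. cutoff (real (Suc n)) s) \<longlonglongrightarrow> 1"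
    by (simp add: cutoff_def divide_inverse del: of_nat_Suc)
  have "(\<lambda>n. 2 * max 0 (1 + inverse (real (Suc n)) * inverse s) * (inverse (real (Suc n)) * (- inverse (s\<^sup>2))))
      \<longlonglongrightarrow> 2 * max 0 (1 + 0 * inverse s) * (0 * (- inverse (s\<^sup>2)))"
    by (intro tendsto_mult tendsto_const a i)
  then show "(\<lambda>n. cutoff' (real (Suc n)) s) \<longlonglongrightarrow> 0"
    by (simp add: cutoff'_def divide_inverse mult.assoc del: of_nat_Suc)
qed

section \<open>Integration over \<Omega>: from the cutoffs to the divergence theorem\<close>

lemma set_integrable_closure:
  fixes f :: "real^'n \<Rightarrow> real"
  assumes "open \<Omega>" "compact (closure \<Omega>)" "continuous_on (closure \<Omega>) f"
  shows "set_integrable lborel \<Omega> f"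
proof -
  have "set_integrable lborel (closure \<Omega>) f"
    unfolding set_integrable_def using assms by (intro borel_integrable_compact)
  then show ?thesis
    by (rule set_integrable_subset) (use assms closure_subset in auto)
qed

lemma compact_bound:
  fixes f :: "'a::topological_space \<Rightarrow> real"
  assumes "compact K" "continuous_on K f"
  obtains M where "M \<ge> 0" "\<And>x. x \<in> K \<Longrightarrow> \<bar>f x\<bar> \<le> M"
proof -
  have "bounded (f ` K)" using assms by (intro compact_imp_bounded compact_continuous_image)
  then obtain M where "\<And>x. x \<in> K \<Longrightarrow> \<bar>f x\<bar> \<le> M"
    unfolding bounded_iff by (metis imageI real_norm_def)
  then show ?thesis by (intro that[of "\<bar>M\<bar>"]) (auto intro: order_trans[OF _ abs_ge_self])
qed

text \<open>The integrand is the partial derivative of \<open>cutoff c (psi x) * f x\<close>;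
  extended by zero, this product is differentiable on the whole space and has bounded
  support.\<close>

lemma integral_cutoff_pd:
  assumes dom: "smooth_bounded_domain psi \<Omega>"
    and V: "open V" "closure \<Omega> \<subseteq> V" and f: "C1_on V f" and c: "c > 0"
  shows "set_integrable lborel \<Omega> (\<lambda>x. cutoff' c (psi x) * pd i psi x * f x + cutoff c (psi x) * pd i f x)"
    and "(LBINT x:\<Omega>. cutoff' c (psi x) * pd i psi x * f x + cutoff c (psi x) * pd i f x) = 0"
proof -
  note D = smooth_bounded_domainD[OF dom]
  have psi1: "C1_on UNIV psi" using D(1) by (rule Ck_on_2_imp_C1_on)
  have psic: "continuous_on UNIV psi" using psi1 by (rule C1_onD)
  have sub: "\<Omega> \<subseteq> closure \<Omega>" "\<Omega> \<subseteq> V" using V(2) closure_subset by blast+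
  define G where "G x = (if x \<in> \<Omega> then cutoff c (psi x) * f x else 0)" for x
  define G' where "G' x = cutoff' c (psi x) * pd i psi x * f x + cutoff c (psi x) * pd i f x" for x
  have inside: "G differentiable at x \<and> pd i G x = G' x" if x: "x \<in> \<Omega>" for x
  proof -
    have px: "psi x < 0" using x D(2) by auto
    have dpsi: "psi differentiable at x" using psi1 C1_onD(1) by blast
    have df: "f differentiable at x" using f C1_onD(1) x sub by blast
    have dc: "(\<lambda>y. cutoff c (psi y)) differentiable at x"
      using has_derivative_compose_DERIV[OF dpsi DERIV_cutoff[OF c px]] unfolding differentiable_def by blast
    have "((\<lambda>y. cutoff c (psi y) * f y) has_derivative
        frechet_derivative (\<lambda>y. cutoff c (psi y) * f y) (at x)) (at x)"
      using dc df by (simp add: frechet_derivative_works[symmetric])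
    then have "(G has_derivative frechet_derivative (\<lambda>y. cutoff c (psi y) * f y) (at x)) (at x)"
      by (rule has_derivative_transform_within_open[OF _ D(3) x]) (simp add: G_def)
    moreover have "pd i G x = pd i (\<lambda>y. cutoff c (psi y) * f y) x"
      by (rule pd_cong_open[OF D(3) x]) (simp add: G_def)
    ultimately show ?thesis
      using pd_mult[OF dc df] pd_compose[OF dpsi DERIV_cutoff[OF c px]]
      unfolding differentiable_def by (auto simp: G'_def)
  qed
  have outside: "G differentiable at x \<and> pd i G x = 0" if x: "x \<notin> \<Omega>" for x
  proof -
    \<comment> \<open>Boundary points and outer points alike have this neighbourhood, on which
      \<open>G\<close> vanishes: its part inside \<Omega> is the strip where the cutoff is
      0.\<close>
    have o: "open {y. - 1 / c < psi y}" by (intro open_Collect_less psic continuous_intros)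
    have "psi x \<ge> 0" using x D(2) by auto
    then have xo: "x \<in> {y. - 1 / c < psi y}" using c by (simp add: order.strict_trans2[of _ 0])
    have z: "0 = G y" if "y \<in> {y. - 1 / c < psi y}" for y
      using that cutoff_eq_0[OF c] by (auto simp: G_def D(2))
    have "((\<lambda>y. 0) has_derivative (\<lambda>v. 0)) (at x)" by simp
    then have "(G has_derivative (\<lambda>v. 0)) (at x)"
      by (rule has_derivative_transform_within_open[OF _ o xo z])
    then show ?thesis using pd_eqI unfolding differentiable_def by fastforce
  qed
  have pdG: "pd i G x = indicator \<Omega> x *\<^sub>R G' x" for x
    using inside outside by (cases "x \<in> \<Omega>") auto
  have cK: "continuous_on (closure \<Omega>) (pd i psi)" "continuous_on (closure \<Omega>) f" "continuous_on (closure \<Omega>) (pd i f)"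
    using V(2) C1_onD[OF f] C1_onD[OF psi1] continuous_on_subset by blast+
  obtain M1 where M1: "M1 \<ge> 0" "\<And>x. x \<in> closure \<Omega> \<Longrightarrow> \<bar>pd i psi x\<bar> \<le> M1"
    using compact_bound[OF D(5) cK(1)] by blast
  obtain M2 where M2: "M2 \<ge> 0" "\<And>x. x \<in> closure \<Omega> \<Longrightarrow> \<bar>f x\<bar> \<le> M2"
    using compact_bound[OF D(5) cK(2)] by blast
  obtain M3 where M3: "M3 \<ge> 0" "\<And>x. x \<in> closure \<Omega> \<Longrightarrow> \<bar>pd i f x\<bar> \<le> M3"
    using compact_bound[OF D(5) cK(3)] by blast
  have bd: "\<bar>pd i G x\<bar> \<le> 2 * c * M1 * M2 + 1 * M3" for x
  proof (cases "x \<in> \<Omega>")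
    case True
    then have px: "psi x < 0" using D(2) by auto
    have "\<bar>G' x\<bar> \<le> \<bar>cutoff' c (psi x)\<bar> * \<bar>pd i psi x\<bar> * \<bar>f x\<bar> + \<bar>cutoff c (psi x)\<bar> * \<bar>pd i f x\<bar>"
      unfolding G'_def abs_mult[symmetric] by (rule abs_triangle_ineq)
    also have "\<dots> \<le> 2 * c * M1 * M2 + 1 * M3"
      using True sub cutoff_bounds[OF c px] M1 M2 M3 c
      by (intro add_mono mult_mono) auto
    finally show ?thesis using True pdG by simp
  qed (use pdG c M1 M2 M3 in auto)
  obtain R where R: "\<And>x. x \<in> \<Omega> \<Longrightarrow> norm x \<le> R" using D(4) by (auto simp: bounded_iff)
  have supp: "norm x \<le> R" if "G x \<noteq> 0" for x using that R by (auto simp: G_def split: if_splits)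
  have dG: "G differentiable at x" for x using inside outside by blast
  note I = integral_pd_compact_support[OF dG bd supp]
  show "set_integrable lborel \<Omega> (\<lambda>x. cutoff' c (psi x) * pd i psi x * f x + cutoff c (psi x) * pd i f x)"
    using I(1) unfolding set_integrable_def by (simp add: pdG[abs_def] G'_def)
  show "(LBINT x:\<Omega>. cutoff' c (psi x) * pd i psi x * f x + cutoff c (psi x) * pd i f x) = 0"
    using I(2) unfolding set_lebesgue_integral_def by (simp add: pdG[abs_def] G'_def)
qed

lemma integral_vdiv_eq_0:
  assumes dom: "smooth_bounded_domain psi \<Omega>"
    and V: "open V" "closure \<Omega> \<subseteq> V" and F: "vC1_on V F"
    and bc: "\<And>x. x \<in> frontier \<Omega> \<Longrightarrow> F x \<bullet> sgrad psi x = 0"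
  shows "(LBINT x:\<Omega>. vdiv F x) = 0"
proof -
  note D = smooth_bounded_domainD[OF dom]
  have sub: "\<Omega> \<subseteq> closure \<Omega>" "\<Omega> \<subseteq> V" using V(2) closure_subset by blast+
  have "C1_on V (\<lambda>x. F x \<bullet> sgrad psi x)"
    using F vC1_on_sgrad[OF D(1)] by (intro C1_on_inner) (auto intro: vC1_on_subset)
  from vanishing_on_frontier_bound[OF dom V this bc]
  obtain C where C: "C \<ge> 0" "\<And>x. x \<in> \<Omega> \<Longrightarrow> \<bar>F x \<bullet> sgrad psi x\<bar> \<le> C * \<bar>psi x\<bar>" by blast
  have cdiv: "continuous_on (closure \<Omega>) (vdiv F)"
    using continuous_on_vdiv[OF F] V(2) continuous_on_subset by blast
  obtain M where M: "M \<ge> 0" "\<And>x. x \<in> closure \<Omega> \<Longrightarrow> \<bar>vdiv F x\<bar> \<le> M"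
    using compact_bound[OF D(5) cdiv] by blast
  \<comment> \<open>The divergence of the field \<open>F\<close> multiplied by the cutoff, expanded
    by the product rule.\<close>
  define q where "q n x = cutoff' (real (Suc n)) (psi x) * (F x \<bullet> sgrad psi x)
      + cutoff (real (Suc n)) (psi x) * vdiv F x" for n x
  have qsum: "q n = (\<lambda>x. \<Sum>i\<in>UNIV. cutoff' (real (Suc n)) (psi x) * pd i psi x * F x $ i
      + cutoff (real (Suc n)) (psi x) * pd i (\<lambda>y. F y $ i) x)" for n
    by (simp add: q_def fun_eq_iff vdiv_def inner_vec_def sgrad_def sum.distrib sum_distrib_left mult_ac
        del: of_nat_Suc)
  have qi: "set_integrable lborel \<Omega> (q n)" for n
    unfolding qsum set_integrable_def scaleR_sum_right
    using integral_cutoff_pd(1)[OF dom V vC1_onD[OF F]]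
    by (intro Bochner_Integration.integrable_sum) (simp add: set_integrable_def)
  have q0: "(LBINT x:\<Omega>. q n x) = 0" for n
    unfolding qsum set_lebesgue_integral_def scaleR_sum_right
    using integral_cutoff_pd[OF dom V vC1_onD[OF F], of "real (Suc n)"]
    by (subst Bochner_Integration.integral_sum)
      (simp_all add: set_lebesgue_integral_def set_integrable_def del: of_nat_Suc real_scaleR_def)
  have lim: "(\<lambda>n. indicator \<Omega> x *\<^sub>R q n x) \<longlonglongrightarrow> indicator \<Omega> x *\<^sub>R vdiv F x" for x
  proof (cases "x \<in> \<Omega>")
    case True
    then have px: "psi x < 0" using D(2) by auto
    have "(\<lambda>n. q n x) \<longlonglongrightarrow> 0 * (F x \<bullet> sgrad psi x) + 1 * vdiv F x"
      unfolding q_def by (intro tendsto_intros cutoff_limits px)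
    then show ?thesis using True by simp
  qed simp
  \<comment> \<open>The large factor \<open>cutoff'\<close> meets a factor bounded by
    \<open>C * \<bar>psi x\<bar>\<close>, and \<open>cutoff'\<close> times \<open>psi\<close> is at
    most 2 for every \<open>n\<close>; hence \<open>2 * C\<close>.\<close>
  have dominated: "norm (indicator \<Omega> x *\<^sub>R q n x) \<le> indicator \<Omega> x *\<^sub>R (2 * C + M)" for n x
  proof (cases "x \<in> \<Omega>")
    case True
    then have px: "psi x < 0" using D(2) by auto
    define c where "c = real (Suc n)"
    have c: "c > 0" by (simp add: c_def)
    note cb = cutoff_bounds[OF c px]
    have "\<bar>q n x\<bar> \<le> \<bar>cutoff' c (psi x)\<bar> * \<bar>F x \<bullet> sgrad psi x\<bar> + \<bar>cutoff c (psi x)\<bar> * \<bar>vdiv F x\<bar>"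
      unfolding q_def c_def abs_mult[symmetric] by (rule abs_triangle_ineq)
    also have "\<bar>cutoff' c (psi x)\<bar> * \<bar>F x \<bullet> sgrad psi x\<bar> \<le> \<bar>cutoff' c (psi x)\<bar> * (C * \<bar>psi x\<bar>)"
      using C(2)[OF True] by (intro mult_left_mono) auto
    also have "\<dots> = \<bar>psi x * cutoff' c (psi x)\<bar> * C" by (simp add: abs_mult)
    also have "\<dots> \<le> 2 * C" using cb C(1) by (intro mult_right_mono) auto
    also have "\<bar>cutoff c (psi x)\<bar> * \<bar>vdiv F x\<bar> \<le> 1 * M"
      using cb M True sub by (intro mult_mono) auto
    finally show ?thesis using True by simp
  qed simp
  have iw: "integrable lborel (\<lambda>x. indicator \<Omega> x *\<^sub>R (2 * C + M))"
    using set_integrable_closure[OF D(3,5), of "\<lambda>_. 2 * C + M"] by (simp add: set_integrable_def)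
  have m1: "(\<lambda>x. indicator \<Omega> x *\<^sub>R vdiv F x) \<in> borel_measurable lborel"
    using set_integrable_closure[OF D(3,5) cdiv] unfolding set_integrable_def by auto
  have m2: "(\<lambda>x. indicator \<Omega> x *\<^sub>R q n x) \<in> borel_measurable lborel" for n
    using qi[of n] unfolding set_integrable_def by auto
  have "(\<lambda>n. LBINT x:\<Omega>. q n x) \<longlonglongrightarrow> (LBINT x:\<Omega>. vdiv F x)"
    unfolding set_lebesgue_integral_def
    by (rule integral_dominated_convergence[OF m1 m2 iw]) (use lim dominated in auto)
  then show ?thesis by (simp add: q0 LIMSEQ_const_iff)
qed

subsection \<open>Potential energy and enthalpy\<close>

text \<open>\<open>pot_energy\<close> is an oriented integral, and \<open>z\<close> may lie on
  either side of \<open>r\<close>. Writing it as \<open>E y - E r\<close>, with \<open>E\<close>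
  integrated from a point below both, reduces the claim to a fixed lower limit.\<close>

lemma DERIV_pot_energy:
  assumes Z: "continuous_on {0<..} Z" and r: "r > 0" and z: "z > 0"
  shows "(pot_energy Z r has_real_derivative Z z / z\<^sup>2) (at z)"
proof -
  \<comment> \<open>\<open>a\<close> is positive, away from the singularity of
    \<open>Z s / s\<^sup>2\<close> at 0, and both \<open>r\<close> and \<open>z\<close> are strictly
    between \<open>a\<close> and \<open>b\<close>.\<close>
  define a b where "a = min r z / 2" and "b = max r z + 1"
  have ab: "0 < a" "a < r" "a < z" "r < b" "z < b" using r z by (auto simp: a_def b_def)
  have c: "continuous_on {0<..} (\<lambda>s. Z s / s\<^sup>2)"
    by (intro continuous_intros Z) auto
  have c': "continuous_on {x..y} (\<lambda>s. Z s / s\<^sup>2)" if "0 < x" for x y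
    using c by (rule continuous_on_subset) (use that in auto)
  define E where "E y = integral {a..y} (\<lambda>s. Z s / s\<^sup>2)" for y
  have dE: "(E has_real_derivative Z y / y\<^sup>2) (at y)" if "a < y" "y < b" for y
  proof -
    have "(E has_real_derivative Z y / y\<^sup>2) (at y within {a..b})"
      unfolding E_def[abs_def] using that ab by (intro integral_has_real_derivative c') auto
    then show ?thesis using that at_within_Icc_at[of a y b] by simp
  qed
  have eq: "pot_energy Z r y = E y - E r" if "a < y" "y < b" for y
    unfolding pot_energy_def
  proof (rule interval_integral_FTC_finite)
    show "continuous_on {min r y..max r y} (\<lambda>s. Z s / s\<^sup>2)"
      using that ab by (intro c') auto
    show "(E has_vector_derivative Z x / x\<^sup>2) (at x within {min r y..max r y})"
      if "min r y \<le> x" "x \<le> max r y" for x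
      using dE[of x] that \<open>a < y\<close> \<open>y < b\<close> ab
      by (auto simp: has_real_derivative_iff_has_vector_derivative min_le_iff_disj le_max_iff_disj
          intro: has_vector_derivative_at_within)
  qed
  have "((\<lambda>y. E y - E r) has_real_derivative Z z / z\<^sup>2) (at z)"
    using dE[of z] ab by (auto intro!: derivative_eq_intros)
  then show ?thesis
    by (rule has_field_derivative_transform_within_open[where S="{a<..<b}"]) (use ab eq in auto)
qed

text \<open>The potential energy is a convex function of the specific volume 1/z, with slope -Z.\<close>
lemma pot_energy_ge_tangent:
  assumes Z: "continuous_on {0<..} Z" and mono: "mono_on {0<..} Z"
    and "r > 0" "z > 0" "w > 0"
  shows "pot_energy Z r z \<ge> pot_energy Z r w - Z w * (1 / z - 1 / w)"
proof -
  \<comment> \<open>The derivative of \<open>f\<close> is \<open>(Z y - Z w) / y\<^sup>2\<close>; as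
    \<open>Z\<close> is monotone, \<open>f\<close> has its minimum at \<open>w\<close>, which is the
    claim.\<close>
  define f where "f y = pot_energy Z r y + Z w / y" for y
  have df: "(f has_real_derivative (Z y - Z w) / y\<^sup>2) (at y)" if "y > 0" for y
    unfolding f_def
    using DERIV_pot_energy[OF Z \<open>r > 0\<close> that] that
    by (auto intro!: derivative_eq_intros simp: power2_eq_square diff_divide_distrib)
  have "f w \<le> f z"
  proof (cases "w \<le> z")
    case True
    then show ?thesis
    proof (rule DERIV_nonneg_imp_nondecreasing)
      fix y assume "w \<le> y" "y \<le> z"
      then show "\<exists>d. (f has_real_derivative d) (at y) \<and> 0 \<le> d"
        using df[of y] \<open>w > 0\<close> mono_onD[OF mono, of w y] by (intro exI[of _ "(Z y - Z w) / y\<^sup>2"]) auto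
    qed
  next
    case False
    then have "z \<le> w" by simp
    then show ?thesis
    proof (rule DERIV_nonpos_imp_nonincreasing)
      fix y assume "z \<le> y" "y \<le> w"
      then show "\<exists>d. (f has_real_derivative d) (at y) \<and> d \<le> 0"
        using df[of y] \<open>z > 0\<close> mono_onD[OF mono, of y w]
        by (intro exI[of _ "(Z y - Z w) / y\<^sup>2"]) (auto simp: divide_le_0_iff)
    qed
  qed
  then show ?thesis by (simp add: f_def algebra_simps)
qed

definition enthalpy :: "(real \<Rightarrow> real) \<Rightarrow> real \<Rightarrow> real \<Rightarrow> real" where
  "enthalpy Z r z = pot_energy Z r z + Z z / z"

text \<open>The derivative \<open>Z z / z\<^sup>2\<close> of the potential energy cancels against
  that of the factor \<open>1 / z\<close> in \<open>Z z / z\<close>, so only the derivative of the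
  pressure survives.\<close>

lemma DERIV_enthalpy:
  assumes Z: "continuous_on {0<..} Z" and r: "r > 0" and z: "z > 0"
    and Z': "(Z has_real_derivative D) (at z)"
  shows "(enthalpy Z r has_real_derivative D / z) (at z)"
  unfolding enthalpy_def[abs_def]
  using DERIV_pot_energy[OF Z r z] Z' z
  by (auto intro!: derivative_eq_intros simp: power2_eq_square field_simps)

definition zeta' :: "real \<Rightarrow> real \<Rightarrow> real \<Rightarrow> real \<Rightarrow> phase \<Rightarrow> real \<Rightarrow> real" where
  "zeta' Ag gg Al gl k z =
     (case k of Gas \<Rightarrow> Ag * gg * z powr (gg - 1) | Liq \<Rightarrow> Al * gl * z powr (gl - 1))"

lemma DERIV_zeta:
  assumes "z > 0"
  shows "(zeta Ag gg Al gl rl0 p0 k has_real_derivative zeta' Ag gg Al gl k z) (at z)"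
  unfolding zeta_def[abs_def] zeta'_def using assms
  by (cases k) (auto intro!: derivative_eq_intros has_real_derivative_powr)

lemma continuous_on_zeta': "continuous_on {0<..} (zeta' Ag gg Al gl k)"
  unfolding zeta'_def[abs_def] by (cases k) (auto intro!: continuous_intros)

lemma continuous_on_zeta: "continuous_on {0<..} (zeta Ag gg Al gl rl0 p0 k)"
  using DERIV_zeta by (intro continuous_at_imp_continuous_on ballI DERIV_isCont) auto

lemma mono_on_zeta:
  assumes "Ag > 0" "Al > 0" "gg > 1" "gl > 1"
  shows "mono_on {0<..} (zeta Ag gg Al gl rl0 p0 k)"
  unfolding zeta_def[abs_def] using assms
  by (cases k) (auto intro!: mono_onI mult_left_mono powr_mono2)

text \<open>The volume fractions sum to 1 at both levels and the pressure Z rho' is common to the phases,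
  so the correction (f' - f) Z rho' cancels in the sum over the phases.\<close>
lemma pot_energy_increment:
  assumes Z: "continuous_on {0<..} Z" and mono: "mono_on {0<..} Z"
    and "r > 0" "rho > 0" "rho' > 0" "f > 0"
  shows "f' * rho' * pot_energy Z r rho' - f * rho * pot_energy Z r rho
      \<le> (f' * rho' - f * rho) * enthalpy Z r rho' - (f' - f) * Z rho'"
proof -
  \<comment> \<open>The tangent is taken at the new density and evaluated at the old one; this
    implicit choice gives the inequality its sign.\<close>
  have "f * rho * (pot_energy Z r rho' - Z rho' * (1 / rho - 1 / rho')) \<le> f * rho * pot_energy Z r rho"
    using assms by (intro mult_left_mono pot_energy_ge_tangent) auto
  moreover have "f * rho * (Z rho' * (1 / rho - 1 / rho')) = f * Z rho' - f * rho * (Z rho' / rho')"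
    "f' * rho' * (Z rho' / rho') = f' * Z rho'"
    using assms by (simp_all add: field_simps)
  ultimately show ?thesis by (simp add: enthalpy_def algebra_simps)
qed

subsection \<open>The energy balance of one phase\<close>

text \<open>Product rule behind integration by parts. \<open>tdiv\<close> differentiates along the
  first index of the tensor, whereas \<open>jac\<close> carries the derivative in its second index;
  hence the transpose.\<close>

lemma tdiv_inner:
  assumes T: "\<And>i j. C1_on V (\<lambda>y. T y $ i $ j)" and w: "vC1_on V w" and x: "x \<in> V"
  shows "tdiv T x \<bullet> w x = vdiv (\<lambda>y. T y *v w y) x - frob (T x) (transpose (jac w x))"
proof -
  have dT: "(\<lambda>y. T y $ i $ j) differentiable at x" for i j using T x by (rule C1_onD)
  have dw: "(\<lambda>y. w y $ j) differentiable at x" for j using vC1_onD[OF w] x by (rule C1_onD)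
  have "vdiv (\<lambda>y. T y *v w y) x
      = (\<Sum>j\<in>UNIV. \<Sum>i\<in>UNIV. T x $ j $ i * pd j (\<lambda>y. w y $ i) x + pd j (\<lambda>y. T y $ j $ i) x * w x $ i)"
    unfolding vdiv_def matrix_vector_mult_def
    by (simp add: pd_sum pd_mult dT dw differentiable_mult)
  also have "\<dots> = frob (T x) (transpose (jac w x))
      + (\<Sum>j\<in>UNIV. \<Sum>i\<in>UNIV. pd j (\<lambda>y. T y $ j $ i) x * w x $ i)"
    by (simp add: sum.distrib frob_def transpose_def jac_def)
  also have "(\<Sum>j\<in>UNIV. \<Sum>i\<in>UNIV. pd j (\<lambda>y. T y $ j $ i) x * w x $ i) = tdiv T x \<bullet> w x"
    by (subst sum.swap) (simp add: tdiv_def inner_vec_def sum_distrib_right)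
  finally show ?thesis by simp
qed

text \<open>The convective work splits into a pure divergence and a multiple of the divergence of
  the mass flux, which Step 1 converts into a change of mass.\<close>

lemma tdiv_convection_inner:
  assumes a: "C1_on V a" and u: "vC1_on V u" and w: "vC1_on V w" and x: "x \<in> V"
  shows "2 * (tdiv (\<lambda>y. a y *\<^sub>R outer (u y) (w y)) x \<bullet> w x)
    = vdiv (\<lambda>y. (w y \<bullet> w y) *\<^sub>R a y *\<^sub>R u y) x + (w x \<bullet> w x) * vdiv (\<lambda>y. a y *\<^sub>R u y) x"
proof -
  have T: "C1_on V (\<lambda>y. (a y *\<^sub>R outer (u y) (w y)) $ i $ j)" for i j
    using C1_on_mult[OF a C1_on_mult[OF vC1_onD[OF u] vC1_onD[OF w]]] by (simp add: outer_def)
  have dw: "(\<lambda>y. w y $ j) differentiable at x" for j using vC1_onD[OF w] x by (rule C1_onD)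
  have Tw: "(a y *\<^sub>R outer (u y) (w y)) *v w y = (w y \<bullet> w y) *\<^sub>R a y *\<^sub>R u y" for y
    by (simp add: vec_eq_iff matrix_vector_mult_def outer_def inner_vec_def sum_distrib_left mult_ac)
  have "sgrad (\<lambda>y. w y \<bullet> w y) x $ i = 2 * (\<Sum>j\<in>UNIV. w x $ j * pd i (\<lambda>y. w y $ j) x)" for i
    by (simp add: sgrad_def inner_vec_def pd_sum pd_mult dw differentiable_mult sum_distrib_left mult_ac)
  then have "sgrad (\<lambda>y. w y \<bullet> w y) x \<bullet> (a x *\<^sub>R u x)
      = 2 * frob (a x *\<^sub>R outer (u x) (w x)) (transpose (jac w x))"
    by (simp add: inner_vec_def frob_def outer_def transpose_def jac_def sum_distrib_left sum_distrib_right mult_ac)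
  moreover have "vdiv (\<lambda>y. (w y \<bullet> w y) *\<^sub>R a y *\<^sub>R u y) x
      = (w x \<bullet> w x) * vdiv (\<lambda>y. a y *\<^sub>R u y) x + sgrad (\<lambda>y. w y \<bullet> w y) x \<bullet> (a x *\<^sub>R u x)"
    by (intro vdiv_scaleR[of V] C1_on_inner vC1_on_scaleR assms)
  ultimately show ?thesis
    using tdiv_inner[OF T w x] unfolding Tw by simp
qed

text \<open>Symmetry removes the transpose left by \<open>tdiv_inner\<close> and yields the
  dissipation in the form used in the estimate.\<close>

lemma stress_transpose: "transpose (stress mu lam w x) = stress mu lam w x"
  by (simp add: stress_def symgrad_def transpose_def vec_eq_iff mat_def add.commute)

lemma frob_transpose: "frob A (transpose B) = frob (transpose A) B"
  unfolding frob_def transpose_def by (subst sum.swap) simp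

lemma C1_on_jac: "vCk_on 2 V w \<Longrightarrow> C1_on V (\<lambda>x. jac w x $ i $ j)"
  by (simp add: vCk_on_def jac_def Ck_on_2_imp_C1_on)

lemma C1_on_stress:
  assumes "vCk_on 2 V w"
  shows "C1_on V (\<lambda>x. stress mu lam w x $ i $ j)"
proof -
  have v: "vdiv w x = (\<Sum>i\<in>UNIV. jac w x $ i $ i)" for x by (simp add: vdiv_def jac_def)
  show ?thesis
    unfolding stress_def symgrad_def v
    by (simp add: transpose_def)
      (intro C1_on_add C1_on_mult C1_on_const C1_on_sum C1_on_jac assms)
qed

lemma vC1_on_matrix_vector_mult:
  assumes "\<And>i j. C1_on V (\<lambda>x. T x $ i $ j)" "vC1_on V w"
  shows "vC1_on V (\<lambda>x. T x *v w x)"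
  unfolding vC1_on_def matrix_vector_mult_def
  by (simp, intro allI C1_on_sum C1_on_mult assms vC1_onD)

lemma vCk_on_2_imp_vC1_on: "vCk_on 2 V w \<Longrightarrow> vC1_on V w"
  unfolding vCk_on_def vC1_on_def using Ck_on_2_imp_C1_on(1) by blast

text \<open>All fields are frozen at one point, so only algebra in an inner product space remains:
  \<open>u\<close>, \<open>w\<close>, \<open>v\<close> stand for the old, intermediate and projected
  velocities, \<open>gp\<close>, \<open>gpt\<close>, \<open>gp'\<close> for the pressure gradients,
  \<open>c\<close>, \<open>s\<close>, \<open>d\<close> for convection, viscosity and drag, and
  \<open>F1\<close>, \<open>F2\<close>, \<open>F3\<close> for divergences that will integrate to
  0.\<close>

lemma phase_energy_balance:
  fixes u w v gp gpt gp' c s d :: "real^'n" and dt a alt phit rhot phit0 rhot0 :: real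
  assumes dt: "dt > 0" and pos: "a > 0" "phit > 0" "rhot > 0" "phit0 > 0" "rhot0 > 0"
    and alt: "alt = phit * rhot"
    and mass: "(alt - a) / dt + q = 0"
    and momentum: "(1 / dt) *\<^sub>R (alt *\<^sub>R w - a *\<^sub>R u) + c + phit *\<^sub>R gpt - s + d = 0"
    and convection: "2 * (c \<bullet> w) = F1 + (w \<bullet> w) * q"
    and viscosity: "s \<bullet> w = F2 - diss"
    and projection: "alt *\<^sub>R ((1 / dt) *\<^sub>R (v - w)) + phit *\<^sub>R (gp' - gpt) = 0"
    and F3: "F3 = gpt \<bullet> ((phit / rhot) *\<^sub>R gpt - sqrt (phit * phit0 / (rhot * rhot0)) *\<^sub>R gp)"
  shows "1/2 * alt * (v \<bullet> v) + dt * diss + 1/2 * dt\<^sup>2 * (phit / rhot * (gp' \<bullet> gp'))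
      + dt * (phit * (v \<bullet> gp')) + dt * (d \<bullet> w)
    \<le> 1/2 * a * (u \<bullet> u) + 1/2 * dt\<^sup>2 * (phit0 / rhot0 * (gp \<bullet> gp))
      + dt * F2 - dt / 2 * F1 + dt\<^sup>2 * F3"
proof -
  have dq: "dt * q = - (alt - a)" using mass dt by (simp add: field_simps)
  have "dt *\<^sub>R ((1 / dt) *\<^sub>R (alt *\<^sub>R w - a *\<^sub>R u) + c + phit *\<^sub>R gpt - s + d) \<bullet> w = 0"
    unfolding momentum by simp
  then have "alt * (w \<bullet> w) - a * (u \<bullet> w) + dt * (c \<bullet> w) + dt * (phit * (w \<bullet> gpt)) - dt * (s \<bullet> w) + dt * (d \<bullet> w) = 0"
    using dt by (simp add: scaleR_add_right scaleR_diff_right inner_add_left inner_diff_left inner_commute algebra_simps)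
  moreover have "2 * (dt * (c \<bullet> w)) = dt * F1 - (w \<bullet> w) * (alt - a)"
    using arg_cong[OF convection, of "\<lambda>z. dt * z"] arg_cong[OF dq, of "\<lambda>z. (w \<bullet> w) * z"] by (simp add: algebra_simps)
  \<comment> \<open>The square of \<open>w - u\<close> is the only loss in the kinetic part.\<close>
  moreover have "0 \<le> a * ((w - u) \<bullet> (w - u))" using pos by simp
  then have "2 * (a * (u \<bullet> w)) \<le> a * (w \<bullet> w) + a * (u \<bullet> u)"
    by (simp add: inner_diff_left inner_diff_right inner_commute algebra_simps)
  ultimately have I: "1/2 * alt * (w \<bullet> w) + dt * (phit * (w \<bullet> gpt)) + dt * diss + dt * (d \<bullet> w)
      \<le> 1/2 * a * (u \<bullet> u) + dt * F2 - dt / 2 * F1"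
    by (simp add: viscosity algebra_simps)

  have "rhot *\<^sub>R (v - w) + dt *\<^sub>R (gp' - gpt)
      = (dt / phit) *\<^sub>R (alt *\<^sub>R ((1 / dt) *\<^sub>R (v - w)) + phit *\<^sub>R (gp' - gpt))"
    using dt pos by (simp add: alt scaleR_add_right)
  then have "rhot *\<^sub>R v + dt *\<^sub>R gp' = rhot *\<^sub>R w + dt *\<^sub>R gpt"
    unfolding projection by (simp add: algebra_simps)
  then have "(rhot *\<^sub>R v + dt *\<^sub>R gp') \<bullet> (rhot *\<^sub>R v + dt *\<^sub>R gp')
      = (rhot *\<^sub>R w + dt *\<^sub>R gpt) \<bullet> (rhot *\<^sub>R w + dt *\<^sub>R gpt)" by simp
  \<comment> \<open>The factor \<open>phit / rhot\<close> turns \<open>rhot\<^sup>2\<close> into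
    \<open>alt\<close> and the mixed terms into \<open>phit\<close> times the work of the pressure
    gradient.\<close>
  then have "phit / rhot * (rhot\<^sup>2 * (v \<bullet> v) + 2 * rhot * dt * (v \<bullet> gp') + dt\<^sup>2 * (gp' \<bullet> gp'))
      = phit / rhot * (rhot\<^sup>2 * (w \<bullet> w) + 2 * rhot * dt * (w \<bullet> gpt) + dt\<^sup>2 * (gpt \<bullet> gpt))"
    by (simp add: inner_add_left inner_add_right inner_commute power2_eq_square algebra_simps)
  then have II: "alt * (v \<bullet> v) + 2 * dt * (phit * (v \<bullet> gp')) + dt\<^sup>2 * (phit / rhot * (gp' \<bullet> gp'))
      = alt * (w \<bullet> w) + 2 * dt * (phit * (w \<bullet> gpt)) + dt\<^sup>2 * (phit / rhot * (gpt \<bullet> gpt))"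
    using pos by (simp add: alt power2_eq_square distrib_left mult_ac)

  \<comment> \<open>These roots factor the coefficient of Step 3 as \<open>b * b0\<close>; Young's
    inequality is then the square of the difference of the weighted gradients.\<close>
  define b b0 where "b = sqrt (phit / rhot)" and "b0 = sqrt (phit0 / rhot0)"
  have b: "b * b = phit / rhot" "b0 * b0 = phit0 / rhot0"
    "sqrt (phit * phit0 / (rhot * rhot0)) = b * b0"
    using pos by (simp_all add: b_def b0_def real_sqrt_mult real_sqrt_divide)
  have "0 \<le> (b *\<^sub>R gpt - b0 *\<^sub>R gp) \<bullet> (b *\<^sub>R gpt - b0 *\<^sub>R gp)" by simp
  also have "\<dots> = b * b * (gpt \<bullet> gpt) - 2 * (b * b0 * (gpt \<bullet> gp)) + b0 * b0 * (gp \<bullet> gp)"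
    by (simp add: inner_diff_left inner_diff_right inner_commute algebra_simps)
  finally have "1/2 * (phit / rhot * (gpt \<bullet> gpt)) \<le> F3 + 1/2 * (phit0 / rhot0 * (gp \<bullet> gp))"
    unfolding F3 b(3) b(1,2)[symmetric] inner_diff_right inner_scaleR_right by simp
  then have "dt\<^sup>2 * (1/2 * (phit / rhot * (gpt \<bullet> gpt))) \<le> dt\<^sup>2 * (F3 + 1/2 * (phit0 / rhot0 * (gp \<bullet> gp)))"
    by (rule mult_left_mono) simp
  \<comment> \<open>Named so that the concluding arithmetic is linear in these quotients.\<close>
  moreover define y1 y2 y3 where "y1 = phit / rhot * (gp' \<bullet> gp')" and "y2 = phit / rhot * (gpt \<bullet> gpt)"
    and "y3 = phit0 / rhot0 * (gp \<bullet> gp)"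
  ultimately show ?thesis
    using I II unfolding y1_def[symmetric] y2_def[symmetric] y3_def[symmetric] by (simp add: distrib_left)
qed

lemma open_positive_set:
  fixes f :: "'a::topological_space \<Rightarrow> real"
  assumes "open U" "continuous_on U f"
  shows "open {x \<in> U. 0 < f x}"
proof -
  have "{x \<in> U. 0 < f x} = U \<inter> f -` {0<..}" by auto
  then show ?thesis using continuous_open_preimage[OF assms(2,1) open_greaterThan] by simp
qed

lemma inner_normal_eq_0_iff:
  "sgrad psi x \<noteq> 0 \<Longrightarrow> X \<bullet> normal psi x = 0 \<longleftrightarrow> X \<bullet> sgrad psi x = 0"
  by (simp add: normal_def)

subsection \<open>The energy estimate\<close>

theorem theorem1:
  fixes \<Omega> :: "(real^'d::finite) set" and psi :: "real^'d \<Rightarrow> real" and U :: "(real^'d) set"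
    and dt CD Ag Al gg gl rl0 p0 :: real
    and mu lam rref :: "phase \<Rightarrow> real"
    and phi rho alt phit rhot pt :: "phase \<Rightarrow> nat \<Rightarrow> real^'d \<Rightarrow> real"
    and u ut ub :: "phase \<Rightarrow> nat \<Rightarrow> real^'d \<Rightarrow> real^'d"
    and p :: "nat \<Rightarrow> real^'d \<Rightarrow> real"
    and m :: nat
  defines "Z \<equiv> zeta Ag gg Al gl rl0 p0"
  assumes dim: "CARD('d) = 2 \<or> CARD('d) = 3"
    and dom: "smooth_bounded_domain psi \<Omega>"
    and dt: "dt > 0"
    and params: "CD > 0" "Ag > 0" "Al > 0" "rl0 > 0" "p0 > 0" "gg > 1" "gl > 1"
    and rref: "\<And>k. rref k > 0"
    \<comment> \<open>regularity: all fields are C^2 on an open neighbourhood U of the closure of Omega\<close>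
    and U: "open U" "closure \<Omega> \<subseteq> U"
    and reg: "\<And>k n. Ck_on 2 U (phi k n) \<and> Ck_on 2 U (rho k n) \<and> Ck_on 2 U (phit k n)
                  \<and> Ck_on 2 U (rhot k n) \<and> Ck_on 2 U (p n) \<and> vCk_on 2 U (u k n)"
             "\<And>k n. Ck_on 2 U (alt k (Suc n)) \<and> Ck_on 2 U (pt k (Suc n))
                  \<and> vCk_on 2 U (ut k (Suc n)) \<and> vCk_on 2 U (ub k (Suc n))"
    \<comment> \<open>positivity\<close>
    and pos: "\<And>k n x. x \<in> closure \<Omega> \<Longrightarrow>
               phi k n x > 0 \<and> rho k n x > 0 \<and> phit k n x > 0 \<and> rhot k n x > 0 \<and> alt k (Suc n) x > 0"
    \<comment> \<open>initial data\<close>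
    and init_vf: "\<And>x. x \<in> \<Omega> \<Longrightarrow> phi Gas 0 x + phi Liq 0 x = 1"
    and init_bc: "\<And>k x. x \<in> frontier \<Omega> \<Longrightarrow> u k 0 x = 0"
    \<comment> \<open>Step 1\<close>
    and step1: "\<And>k n x. x \<in> \<Omega> \<Longrightarrow>
               (alt k (Suc n) x - phi k n x * rho k n x) / dt
               + vdiv (\<lambda>y. alt k (Suc n) y *\<^sub>R u k n y) x = 0"
    \<comment> \<open>Step 2\<close>
    and step2: "\<And>n x. x \<in> \<Omega> \<Longrightarrow>
               phit Gas (Suc n) x + phit Liq (Suc n) x = 1
               \<and> (\<forall>k. phit k (Suc n) x * rhot k (Suc n) x = alt k (Suc n) x)
               \<and> Z Gas (rhot Gas (Suc n) x) = Z Liq (rhot Liq (Suc n) x)"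
    \<comment> \<open>Step 3\<close>
    and step3: "\<And>k n x. x \<in> \<Omega> \<Longrightarrow>
               vdiv (\<lambda>y. (phit k (Suc n) y / rhot k (Suc n) y) *\<^sub>R sgrad (pt k (Suc n)) y) x
               = vdiv (\<lambda>y. sqrt (phit k (Suc n) y * phit k n y / (rhot k (Suc n) y * rhot k n y))
                            *\<^sub>R sgrad (p n) y) x"
    and step3_bc: "\<And>k n x. x \<in> frontier \<Omega> \<Longrightarrow>
               (phit k (Suc n) x / rhot k (Suc n) x) * dnormal psi (pt k (Suc n)) x
               = sqrt (phit k (Suc n) x * phit k n x / (rhot k (Suc n) x * rhot k n x))
                 * dnormal psi (p n) x"
    \<comment> \<open>Step 4\<close>
    and step4: "\<And>k n x. x \<in> \<Omega> \<Longrightarrow>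
               (1 / dt) *\<^sub>R (alt k (Suc n) x *\<^sub>R ut k (Suc n) x - (phi k n x * rho k n x) *\<^sub>R u k n x)
               + tdiv (\<lambda>y. alt k (Suc n) y *\<^sub>R outer (u k n y) (ut k (Suc n) y)) x
               + phit k (Suc n) x *\<^sub>R sgrad (pt k (Suc n)) x
               - tdiv (\<lambda>y. phit k (Suc n) y *\<^sub>R stress (mu k) (lam k) (ut k (Suc n)) y) x
               + (CD * phit Gas (Suc n) x * phit Liq (Suc n) x * norm (ut Gas (Suc n) x - ut Liq (Suc n) x))
                 *\<^sub>R (ut k (Suc n) x - ut (other k) (Suc n) x) = 0"
    and step4_bc: "\<And>k n x. x \<in> frontier \<Omega> \<Longrightarrow> ut k (Suc n) x = 0"
    \<comment> \<open>Step 5 (projection)\<close>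
    and step5a: "\<And>k n x. x \<in> \<Omega> \<Longrightarrow>
               alt k (Suc n) x *\<^sub>R ((1 / dt) *\<^sub>R (ub k (Suc n) x - ut k (Suc n) x))
               + phit k (Suc n) x *\<^sub>R sgrad (\<lambda>y. p (Suc n) y - pt k (Suc n) y) x = 0"
    and step5b: "\<And>k n x. x \<in> \<Omega> \<Longrightarrow>
               (phi k (Suc n) x * rho k (Suc n) x - phi k n x * rho k n x) / dt
               + vdiv (\<lambda>y. (phit k (Suc n) y * rho k (Suc n) y) *\<^sub>R ub k (Suc n) y) x = 0"
    and step5c: "\<And>n x. x \<in> \<Omega> \<Longrightarrow> phi Gas (Suc n) x + phi Liq (Suc n) x = 1"
    and step5d: "\<And>k n x. x \<in> \<Omega> \<Longrightarrow> Z k (rho k (Suc n) x) = p (Suc n) x"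
    and step5_bc: "\<And>k n x. x \<in> frontier \<Omega> \<Longrightarrow>
               dnormal psi (p (Suc n)) x = dnormal psi (pt k (Suc n)) x
               \<and> ub k (Suc n) x \<bullet> normal psi x = 0"
    \<comment> \<open>Step 6\<close>
    and step6: "\<And>k n x. x \<in> \<Omega> \<Longrightarrow>
               sqrt (phi k (Suc n) x * rho k (Suc n) x) *\<^sub>R u k (Suc n) x
               = sqrt (alt k (Suc n) x) *\<^sub>R ub k (Suc n) x"
  shows
    "(\<Sum>k\<in>{Gas, Liq}.
        (1/2) * (LBINT x:\<Omega>. (norm (sqrt (phi k (Suc m) x * rho k (Suc m) x) *\<^sub>R u k (Suc m) x))\<^sup>2)
      + (LBINT x:\<Omega>. phi k (Suc m) x * rho k (Suc m) x * pot_energy (Z k) (rref k) (rho k (Suc m) x))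
      + dt * (\<Sum>j\<le>m. LBINT x:\<Omega>. phit k (Suc j) x
                 * frob (stress (mu k) (lam k) (ut k (Suc j)) x) (jac (ut k (Suc j)) x))
      + (1/2) * dt\<^sup>2 * (LBINT x:\<Omega>.
                 (norm (sqrt (phit k (Suc m) x / rhot k (Suc m) x) *\<^sub>R sgrad (p (Suc m)) x))\<^sup>2))
     + dt * (\<Sum>j\<le>m. LBINT x:\<Omega>. CD * phit Gas (Suc j) x * phit Liq (Suc j) x
                 * (norm (ut Gas (Suc j) x - ut Liq (Suc j) x)) ^ 3)
     \<le> (\<Sum>k\<in>{Gas, Liq}.
        (1/2) * (LBINT x:\<Omega>. (norm (sqrt (phi k 0 x * rho k 0 x) *\<^sub>R u k 0 x))\<^sup>2)
      + (LBINT x:\<Omega>. phi k 0 x * rho k 0 x * pot_energy (Z k) (rref k) (rho k 0 x))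
      + (1/2) * dt\<^sup>2 * (LBINT x:\<Omega>.
                 (norm (sqrt (phit k 0 x / rhot k 0 x) *\<^sub>R sgrad (p 0) x))\<^sup>2))"
proof -
  note D = smooth_bounded_domainD[OF dom]
  define K where "K = closure \<Omega>"
  have K: "compact K" "\<Omega> \<subseteq> K" "frontier \<Omega> \<subseteq> K" "K \<subseteq> U"
    using D(5) U(2) closure_subset by (auto simp: K_def frontier_def)
  have posK: "phi k n x > 0" "rho k n x > 0" "phit k n x > 0" "rhot k n x > 0" "alt k (Suc n) x > 0"
    if "x \<in> K" for k n x using pos[of x k n] that by (auto simp: K_def)
  have Zc: "continuous_on {0<..} (Z k)" and Zm: "mono_on {0<..} (Z k)"
    and dZ: "z > 0 \<Longrightarrow> (Z k has_real_derivative zeta' Ag gg Al gl k z) (at z)" for k z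
    unfolding Z_def by (intro continuous_on_zeta mono_on_zeta DERIV_zeta params | assumption)+
  have reg1: "C1_on U (phi k n)" "C1_on U (rho k n)" "C1_on U (phit k n)" "C1_on U (rhot k n)"
    "C1_on U (p n)" "vC1_on U (u k n)" "vC1_on U (sgrad (p n))" for k n
    using reg(1)[of k n] by (auto intro: Ck_on_2_imp_C1_on vCk_on_2_imp_vC1_on vC1_on_sgrad)
  have reg2: "C1_on U (alt k (Suc n))" "C1_on U (pt k (Suc n))" "vC1_on U (sgrad (pt k (Suc n)))"
    "vC1_on U (ut k (Suc n))" "vC1_on U (ub k (Suc n))" for k n
    using reg(2)[of k n] by (auto intro: Ck_on_2_imp_C1_on vCk_on_2_imp_vC1_on vC1_on_sgrad)
  have cont1: "continuous_on K (phi k n)" "continuous_on K (rho k n)" "continuous_on K (phit k n)"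
    "continuous_on K (rhot k n)" "continuous_on K (u k n)" "continuous_on K (sgrad (p n))" for k n
    by (intro continuous_on_subset[OF C1_onD(3) K(4)] continuous_on_subset[OF vC1_on_continuous K(4)] reg1)+
  have cont2: "continuous_on K (ut k (Suc n))" for k n
    by (intro continuous_on_subset[OF vC1_on_continuous K(4)] reg2)
  have integrable: "set_integrable lborel \<Omega> f" if "continuous_on K f" for f :: "real^'d \<Rightarrow> real"
    using set_integrable_closure[OF D(3,5)] that unfolding K_def by blast

  \<comment> \<open>Energies, fluxes and the total divergence\<close>
  define h where "h k = enthalpy (Z k) (rref k)" for k
  define KE where "KE k n x = (norm (sqrt (phi k n x * rho k n x) *\<^sub>R u k n x))\<^sup>2" for k n x
  define PE where "PE k n x = phi k n x * rho k n x * pot_energy (Z k) (rref k) (rho k n x)" for k n x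
  define PR where "PR k n x = (norm (sqrt (phit k n x / rhot k n x) *\<^sub>R sgrad (p n) x))\<^sup>2" for k n x
  define VS where "VS k n x = phit k n x * frob (stress (mu k) (lam k) (ut k n) x) (jac (ut k n) x)" for k n x
  define DR where "DR n x = CD * phit Gas n x * phit Liq n x * (norm (ut Gas n x - ut Liq n x)) ^ 3" for n x
  \<comment> \<open>\<open>F1\<close> is twice the flux of kinetic energy, \<open>F2\<close> that of
    viscous work, \<open>F3\<close> the field of Step 3 weighted by the intermediate pressure, and
    \<open>F4\<close> the enthalpy flux.\<close>
  define F1 where "F1 k n y = (ut k (Suc n) y \<bullet> ut k (Suc n) y) *\<^sub>R alt k (Suc n) y *\<^sub>R u k n y" for k n y
  define F2 where "F2 k n y = (phit k (Suc n) y *\<^sub>R stress (mu k) (lam k) (ut k (Suc n)) y) *v ut k (Suc n) y" for k n y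
  define G where "G k n y = (phit k (Suc n) y / rhot k (Suc n) y) *\<^sub>R sgrad (pt k (Suc n)) y
      - sqrt (phit k (Suc n) y * phit k n y / (rhot k (Suc n) y * rhot k n y)) *\<^sub>R sgrad (p n) y" for k n y
  define F3 where "F3 k n y = pt k (Suc n) y *\<^sub>R G k n y" for k n y
  define F4 where "F4 k n y = h k (rho k (Suc n) y) *\<^sub>R (phit k (Suc n) y * rho k (Suc n) y) *\<^sub>R ub k (Suc n) y" for k n y
  \<comment> \<open>The weights are those left by \<open>phase_energy_balance\<close>; the last term
    comes from the mass equation of Step 5, which replaces the work of the new pressure.\<close>
  define W where "W k n x = dt * vdiv (F2 k n) x - dt / 2 * vdiv (F1 k n) x
      + dt\<^sup>2 * vdiv (F3 k n) x - dt * vdiv (F4 k n) x" for k n x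

  \<comment> \<open>Integrability of the energies and regularity of the fluxes\<close>
  have KEi: "set_integrable lborel \<Omega> (KE k n)" for k n
    unfolding KE_def[abs_def] by (intro integrable continuous_intros cont1)
  have PEi: "set_integrable lborel \<Omega> (PE k n)" for k n
  proof -
    have "continuous_on {0<..} (pot_energy (Z k) (rref k))"
      using DERIV_pot_energy[OF Zc rref] by (intro continuous_at_imp_continuous_on ballI DERIV_isCont) auto
    then have "continuous_on K (\<lambda>x. pot_energy (Z k) (rref k) (rho k n x))"
      by (rule continuous_on_compose2[OF _ cont1(2)]) (use posK in auto)
    then show ?thesis unfolding PE_def[abs_def] by (intro integrable continuous_intros cont1)
  qed
  have PRi: "set_integrable lborel \<Omega> (PR k n)" for k n
    unfolding PR_def[abs_def]
    by (intro integrable continuous_intros cont1) (metis posK(4) less_irrefl)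
  have VSi: "set_integrable lborel \<Omega> (VS k (Suc n))" for k n
    unfolding VS_def[abs_def] frob_def using K(4) reg(2)[of k n]
    by (intro integrable continuous_intros cont1 continuous_on_subset[OF C1_onD(3)[OF C1_on_jac]]
        continuous_on_subset[OF C1_onD(3)[OF C1_on_stress]]) auto
  have DRi: "set_integrable lborel \<Omega> (DR (Suc n))" for n
    unfolding DR_def[abs_def] by (intro integrable continuous_intros cont1 cont2)

  \<comment> \<open>A neighbourhood of the closure on which everything that is divided by, put under
    a root or inserted into the enthalpy is positive; it is open by continuity.\<close>
  define V where "V k n = {x \<in> U. 0 < phit k (Suc n) x} \<inter> {x \<in> U. 0 < phit k n x} \<inter> {x \<in> U. 0 < rhot k (Suc n) x}
      \<inter> {x \<in> U. 0 < rhot k n x} \<inter> {x \<in> U. 0 < rho k (Suc n) x}" for k n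
  have V: "open (V k n)" "K \<subseteq> V k n" "V k n \<subseteq> U" for k n
  proof -
    show "open (V k n)"
      unfolding V_def by (intro open_Int open_positive_set U C1_onD(3) reg1)
    show "K \<subseteq> V k n" "V k n \<subseteq> U" using K posK unfolding V_def by auto
  qed
  have hV: "C1_on (V k n) (\<lambda>y. h k (rho k (Suc n) y))" for k n
  proof (rule C1_on_compose[where f = "rho k (Suc n)" and g = "h k" and g' = "\<lambda>z. zeta' Ag gg Al gl k z / z"])
    show "C1_on (V k n) (rho k (Suc n))" using reg1(2) V(3) by (rule C1_on_subset)
    show "(h k has_real_derivative zeta' Ag gg Al gl k (rho k (Suc n) x) / rho k (Suc n) x) (at (rho k (Suc n) x))"
      if "x \<in> V k n" for x
      unfolding h_def using that by (intro DERIV_enthalpy Zc rref dZ) (auto simp: V_def)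
    have "rho k (Suc n) ` V k n \<subseteq> {0<..}" by (auto simp: V_def)
    then show "continuous_on (rho k (Suc n) ` V k n) (\<lambda>z. zeta' Ag gg Al gl k z / z)"
      by (intro continuous_intros continuous_on_subset[OF continuous_on_zeta']) auto
  qed
  have GV: "vC1_on (V k n) (\<lambda>y. (phit k (Suc n) y / rhot k (Suc n) y) *\<^sub>R sgrad (pt k (Suc n)) y)"
    "vC1_on (V k n) (\<lambda>y. sqrt (phit k (Suc n) y * phit k n y / (rhot k (Suc n) y * rhot k n y)) *\<^sub>R sgrad (p n) y)"
    for k n
    by (intro vC1_on_scaleR C1_on_divide C1_on_sqrt C1_on_mult
        reg1(3,4)[THEN C1_on_subset[OF _ V(3)]] reg1(7)[THEN vC1_on_subset[OF _ V(3)]]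
        reg2(3)[THEN vC1_on_subset[OF _ V(3)]]; force simp: V_def)+
  have T2: "C1_on U (\<lambda>y. (phit k (Suc n) y *\<^sub>R stress (mu k) (lam k) (ut k (Suc n)) y) $ i $ j)" for k n i j
    using C1_on_mult[OF reg1(3) C1_on_stress] reg(2)[of k n] by simp
  have FV: "vC1_on (V k n) (F1 k n)" "vC1_on (V k n) (F2 k n)" "vC1_on (V k n) (F3 k n)"
    "vC1_on (V k n) (F4 k n)" for k n
  proof -
    show "vC1_on (V k n) (F1 k n)"
      unfolding F1_def[abs_def] by (intro vC1_on_subset[OF _ V(3)] vC1_on_scaleR C1_on_inner reg1 reg2)
    show "vC1_on (V k n) (F2 k n)"
      unfolding F2_def[abs_def] by (intro vC1_on_subset[OF _ V(3)] vC1_on_matrix_vector_mult T2 reg2)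
    show "vC1_on (V k n) (F3 k n)"
      unfolding F3_def[abs_def] G_def
      by (intro vC1_on_scaleR vC1_on_diff GV C1_on_subset[OF reg2(2) V(3)])
    show "vC1_on (V k n) (F4 k n)"
      unfolding F4_def[abs_def]
      by (intro vC1_on_scaleR C1_on_mult hV C1_on_subset[OF reg1(3) V(3)]
          C1_on_subset[OF reg1(2) V(3)] vC1_on_subset[OF reg2(5) V(3)])
  qed
  have divi: "set_integrable lborel \<Omega> (vdiv (F k n))" if "vC1_on (V k n) (F k n)" for F and k :: phase and n :: nat
    using continuous_on_subset[OF continuous_on_vdiv[OF that] V(2)] by (rule integrable)
  have div0: "(LBINT x:\<Omega>. vdiv (F k n) x) = 0"
    if "vC1_on (V k n) (F k n)" "\<And>x. x \<in> frontier \<Omega> \<Longrightarrow> F k n x \<bullet> sgrad psi x = 0"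
    for F and k :: phase and n :: nat
    using integral_vdiv_eq_0[OF dom V(1) _ that] V(2) unfolding K_def by blast
  have Wi: "set_integrable lborel \<Omega> (W k n)" for k n
    unfolding W_def[abs_def] by (intro set_integral_add set_integral_diff set_integrable_mult_right divi FV)
  \<comment> \<open>Each flux is tangential for its own reason: \<open>F1\<close> and
    \<open>F2\<close> vanish with \<open>ut\<close> on the boundary, \<open>F3\<close> uses the
    boundary condition of Step 3, and \<open>F4\<close> the zero normal component of
    \<open>ub\<close>.\<close>
  have W0: "(LBINT x:\<Omega>. W k n x) = 0" for k n
  proof -
    have "(LBINT x:\<Omega>. vdiv (F1 k n) x) = 0"
      by (rule div0[OF FV(1)]) (simp add: F1_def step4_bc)
    moreover have "(LBINT x:\<Omega>. vdiv (F2 k n) x) = 0"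
      by (rule div0[OF FV(2)]) (simp add: F2_def step4_bc)
    moreover have "(LBINT x:\<Omega>. vdiv (F3 k n) x) = 0"
    proof (rule div0[OF FV(3)])
      fix x assume x: "x \<in> frontier \<Omega>"
      have "G k n x \<bullet> normal psi x = 0"
        using step3_bc[OF x, of k n] by (simp add: G_def inner_diff_left dnormal_def)
      then show "F3 k n x \<bullet> sgrad psi x = 0"
        using inner_normal_eq_0_iff[OF D(7)[OF x]] by (simp add: F3_def)
    qed
    moreover have "(LBINT x:\<Omega>. vdiv (F4 k n) x) = 0"
    proof (rule div0[OF FV(4)])
      fix x assume x: "x \<in> frontier \<Omega>"
      then have "ub k (Suc n) x \<bullet> sgrad psi x = 0"
        using step5_bc[OF x, of n k] inner_normal_eq_0_iff[OF D(7)[OF x]] by simp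
      then show "F4 k n x \<bullet> sgrad psi x = 0" by (simp add: F4_def)
    qed
    ultimately show ?thesis
      unfolding W_def
      by (simp add: divi FV set_integral_add set_integral_diff)
  qed

  \<comment> \<open>The energy inequality of one phase at a point of \<Omega>\<close>
  have phase: "1/2 * KE k (Suc n) x + dt * VS k (Suc n) x + 1/2 * dt\<^sup>2 * PR k (Suc n) x
      + (phi k (Suc n) x * rho k (Suc n) x - phi k n x * rho k n x) * h k (rho k (Suc n) x)
      + dt * (CD * phit Gas (Suc n) x * phit Liq (Suc n) x * norm (ut Gas (Suc n) x - ut Liq (Suc n) x))
          * ((ut k (Suc n) x - ut (other k) (Suc n) x) \<bullet> ut k (Suc n) x)
      \<le> 1/2 * KE k n x + 1/2 * dt\<^sup>2 * PR k n x + W k n x" if x: "x \<in> \<Omega>" for k n x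
  proof -
    have xK: "x \<in> K" and xU: "x \<in> U" and xV: "x \<in> V k n" using x K V(2) by blast+
    have alt: "alt k (Suc n) x = phit k (Suc n) x * rhot k (Suc n) x" using step2[OF x, of n] by auto
    have proj: "alt k (Suc n) x *\<^sub>R ((1 / dt) *\<^sub>R (ub k (Suc n) x - ut k (Suc n) x))
        + phit k (Suc n) x *\<^sub>R (sgrad (p (Suc n)) x - sgrad (pt k (Suc n)) x) = 0"
    proof -
      have "sgrad (\<lambda>y. p (Suc n) y - pt k (Suc n) y) x = sgrad (p (Suc n)) x - sgrad (pt k (Suc n)) x"
        using C1_onD(1)[OF reg1(5) xU] C1_onD(1)[OF reg2(2) xU]
        by (simp add: sgrad_def vec_eq_iff pd_diff)
      then show ?thesis using step5a[OF x, of k n] by simp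
    qed
    have visc: "tdiv (\<lambda>y. phit k (Suc n) y *\<^sub>R stress (mu k) (lam k) (ut k (Suc n)) y) x \<bullet> ut k (Suc n) x
        = vdiv (F2 k n) x - VS k (Suc n) x"
      unfolding tdiv_inner[OF T2 reg2(4) xU] F2_def[abs_def] frob_transpose
      by (simp add: VS_def transpose_scalar stress_transpose frob_def sum_distrib_left mult_ac)
    \<comment> \<open>Step 3 makes \<open>G k n\<close> divergence free, so the product rule leaves
      only the gradient of the weight \<open>pt\<close>.\<close>
    have F3: "vdiv (F3 k n) x = sgrad (pt k (Suc n)) x \<bullet> G k n x"
    proof -
      have "vdiv (G k n) x = 0"
        unfolding G_def[abs_def] using vdiv_diff[OF GV xV] step3[OF x, of k n] by simp
      moreover have "vC1_on (V k n) (G k n)" unfolding G_def[abs_def] by (intro vC1_on_diff GV)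
      ultimately show ?thesis
        unfolding F3_def[abs_def] using vdiv_scaleR[OF C1_on_subset[OF reg2(2) V(3)] _ xV] by simp
    qed
    \<comment> \<open>The work of the new pressure gradient becomes a divergence plus the mass
      increment weighted by the enthalpy, the quantity that \<open>pot_energy_increment\<close>
      compares with the potential energy.\<close>
    have F4: "dt * vdiv (F4 k n) x
        = dt * (phit k (Suc n) x * (ub k (Suc n) x \<bullet> sgrad (p (Suc n)) x))
          - (phi k (Suc n) x * rho k (Suc n) x - phi k n x * rho k n x) * h k (rho k (Suc n) x)"
    proof -
      have r0: "rho k (Suc n) x > 0" using posK xK by blast
      have dr: "rho k (Suc n) differentiable at x" using reg1(2) xU by (rule C1_onD)
      have "pd i (\<lambda>y. h k (rho k (Suc n) y)) x = zeta' Ag gg Al gl k (rho k (Suc n) x) / rho k (Suc n) x * pd i (rho k (Suc n)) x" for i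
        unfolding h_def by (intro pd_compose dr DERIV_enthalpy Zc rref dZ r0)
      moreover have "pd i (p (Suc n)) x = zeta' Ag gg Al gl k (rho k (Suc n) x) * pd i (rho k (Suc n)) x" for i
      proof -
        have "pd i (p (Suc n)) x = pd i (\<lambda>y. Z k (rho k (Suc n) y)) x"
          by (rule pd_cong_open[OF D(3) x]) (simp add: step5d)
        then show ?thesis using pd_compose[OF dr dZ[OF r0]] by simp
      qed
      ultimately have g: "sgrad (\<lambda>y. h k (rho k (Suc n) y)) x = (1 / rho k (Suc n) x) *\<^sub>R sgrad (p (Suc n)) x"
        by (simp add: sgrad_def vec_eq_iff)
      have "vdiv (F4 k n) x = h k (rho k (Suc n) x) * vdiv (\<lambda>y. (phit k (Suc n) y * rho k (Suc n) y) *\<^sub>R ub k (Suc n) y) x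
          + sgrad (\<lambda>y. h k (rho k (Suc n) y)) x \<bullet> ((phit k (Suc n) x * rho k (Suc n) x) *\<^sub>R ub k (Suc n) x)"
        unfolding F4_def[abs_def]
        by (intro vdiv_scaleR[OF hV _ xV] vC1_on_scaleR C1_on_mult C1_on_subset[OF reg1(3) V(3)]
          C1_on_subset[OF reg1(2) V(3)] vC1_on_subset[OF reg2(5) V(3)])
      also have "sgrad (\<lambda>y. h k (rho k (Suc n) y)) x \<bullet> ((phit k (Suc n) x * rho k (Suc n) x) *\<^sub>R ub k (Suc n) x)
          = phit k (Suc n) x * (ub k (Suc n) x \<bullet> sgrad (p (Suc n)) x)"
        using r0 by (simp add: g inner_commute)
      also have "vdiv (\<lambda>y. (phit k (Suc n) y * rho k (Suc n) y) *\<^sub>R ub k (Suc n) y) x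
          = - (phi k (Suc n) x * rho k (Suc n) x - phi k n x * rho k n x) / dt"
        unfolding minus_divide_left[symmetric] using step5b[OF x, of k n] by linarith
      finally show ?thesis using dt by (simp add: field_simps)
    qed
    \<comment> \<open>Step 6 identifies the energy delivered by the projection with the kinetic
      energy of the new level.\<close>
    have KE': "KE k (Suc n) x = alt k (Suc n) x * (ub k (Suc n) x \<bullet> ub k (Suc n) x)"
      using posK(5)[OF xK, of k n] by (simp add: KE_def step6[OF x] power_mult_distrib dot_square_norm)
    have KE: "KE k n x = phi k n x * rho k n x * (u k n x \<bullet> u k n x)"
      using posK[OF xK, of k n] by (simp add: KE_def power_mult_distrib dot_square_norm)
    have PR: "PR k j x = phit k j x / rhot k j x * (sgrad (p j) x \<bullet> sgrad (p j) x)" for j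
      using posK[OF xK, of k j] by (simp add: PR_def power_mult_distrib dot_square_norm)
    have "0 < phi k n x * rho k n x" using posK[OF xK, of k n] by simp
    from phase_energy_balance[OF dt this posK(3,4)[OF xK] posK(3,4)[OF xK] alt step1[OF x] step4[OF x]
        tdiv_convection_inner[OF reg2(1) reg1(6) reg2(4) xU] visc proj F3[unfolded G_def]]
    show ?thesis
      unfolding KE KE' PR W_def F4 F1_def[symmetric, abs_def] by (simp add: algebra_simps)
  qed

  \<comment> \<open>Summation over the two phases\<close>
  have pointwise: "(\<Sum>k\<in>{Gas, Liq}. 1/2 * KE k (Suc n) x + PE k (Suc n) x + dt * VS k (Suc n) x + 1/2 * dt\<^sup>2 * PR k (Suc n) x)
      + dt * DR (Suc n) x
      \<le> (\<Sum>k\<in>{Gas, Liq}. 1/2 * KE k n x + PE k n x + 1/2 * dt\<^sup>2 * PR k n x + W k n x)"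
    if x: "x \<in> \<Omega>" for n x
  proof -
    have xK: "x \<in> K" using x K by blast
    have PE: "PE k (Suc n) x - PE k n x
        \<le> (phi k (Suc n) x * rho k (Suc n) x - phi k n x * rho k n x) * h k (rho k (Suc n) x)
          - (phi k (Suc n) x - phi k n x) * p (Suc n) x" for k
      using pot_energy_increment[OF Zc[of k] Zm[of k] rref[of k] posK(2)[OF xK, of k n]
          posK(2)[OF xK, of k "Suc n"] posK(1)[OF xK, of k n], of "phi k (Suc n) x"]
      unfolding PE_def h_def by (simp add: step5d[OF x])
    \<comment> \<open>Level 0 is covered by the initial data, every later level by Step 5.\<close>
    have vf: "phi Gas j x + phi Liq j x = 1" for j
      using init_vf[OF x] step5c[OF x] by (cases j) auto
    have "(phi Gas (Suc n) x - phi Gas n x) * p (Suc n) x + (phi Liq (Suc n) x - phi Liq n x) * p (Suc n) x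
        = ((phi Gas (Suc n) x + phi Liq (Suc n) x) - (phi Gas n x + phi Liq n x)) * p (Suc n) x"
      by (simp add: algebra_simps)
    then have cancel: "(phi Gas (Suc n) x - phi Gas n x) * p (Suc n) x
        + (phi Liq (Suc n) x - phi Liq n x) * p (Suc n) x = 0" by (simp add: vf)
    define g l where "g = ut Gas (Suc n) x" and "l = ut Liq (Suc n) x"
    define c where "c = dt * (CD * phit Gas (Suc n) x * phit Liq (Suc n) x * norm (g - l))"
    \<comment> \<open>The drag forces are opposite, so their work adds up to the square of
      \<open>g - l\<close>; the factor \<open>norm (g - l)\<close> inside \<open>c\<close> makes it
      the cube in \<open>DR\<close>.\<close>
    have "c * ((g - l) \<bullet> g) + c * ((l - g) \<bullet> l) = c * ((g - l) \<bullet> (g - l))"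
      by (simp add: inner_diff_left inner_diff_right inner_commute algebra_simps)
    also have "\<dots> = dt * DR (Suc n) x"
      by (simp add: c_def DR_def g_def l_def dot_square_norm power3_eq_cube power2_eq_square)
    finally show ?thesis
      using phase[OF x, of Gas n] phase[OF x, of Liq n] PE[of Gas] PE[of Liq] cancel
      unfolding g_def[symmetric] l_def[symmetric] other.simps c_def by simp
  qed

  \<comment> \<open>Integration over \<Omega> and telescoping in time\<close>
  define E where "E n = (\<Sum>k\<in>{Gas, Liq}. 1/2 * (LBINT x:\<Omega>. KE k n x) + (LBINT x:\<Omega>. PE k n x)
      + 1/2 * dt\<^sup>2 * (LBINT x:\<Omega>. PR k n x))" for n
  define Q where "Q n = (\<Sum>k\<in>{Gas, Liq}. dt * (LBINT x:\<Omega>. VS k n x)) + dt * (LBINT x:\<Omega>. DR n x)" for n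
  have step: "E (Suc n) + Q (Suc n) \<le> E n" for n
  proof -
    note ints = KEi PEi PRi VSi DRi Wi
    have "(LBINT x:\<Omega>. (\<Sum>k\<in>{Gas, Liq}. 1/2 * KE k (Suc n) x + PE k (Suc n) x + dt * VS k (Suc n) x + 1/2 * dt\<^sup>2 * PR k (Suc n) x)
        + dt * DR (Suc n) x)
      \<le> (LBINT x:\<Omega>. (\<Sum>k\<in>{Gas, Liq}. 1/2 * KE k n x + PE k n x + 1/2 * dt\<^sup>2 * PR k n x + W k n x))"
      by (rule set_integral_mono) (use ints pointwise in \<open>auto simp: set_integral_add\<close>)
    then show ?thesis
      by (simp add: E_def Q_def ints set_integral_add W0)
  qed
  \<comment> \<open>The dissipation \<open>Q\<close> enters only at levels \<open>Suc j\<close>,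
    since intermediate velocities belong to the scheme from level 1 on.\<close>
  have "E (Suc m) + (\<Sum>j\<le>m. Q (Suc j)) \<le> E 0"
  proof (induction m)
    case 0 then show ?case using step[of 0] by simp
  next
    case (Suc m) then show ?case using step[of "Suc m"] by simp
  qed
  then show ?thesis
    unfolding E_def Q_def KE_def[symmetric] PE_def[symmetric] PR_def[symmetric] VS_def[symmetric] DR_def[symmetric]
    by (simp add: sum.distrib sum_distrib_left algebra_simps)
qed

end
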